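(* Let $d\ge 1$, let $\Sigma$ be a fixed $d\times d$ positive definite matrix, and let $A_i = \Sigma^{1/2} G_i^{\rm c}$ $(i=1,2,\dots)$, where the $G_i^{\rm c}$ are independent $d\times d$ complex Gaussian matrices whose entries are independent standard complex normals. Let $y_1,\dots,y_d$ denote the eigenvalues of $\Sigma^{-1}$, and let $\mu_1\ge\cdots\ge\mu_d$ be the Lyapunov exponents of the product $P_N = A_N A_{N-1}\cdots A_1$. Then $$\mu_1+\mu_2+\cdots+\mu_d = \frac12\sum_{m=1}^d\Big(-\log y_m+\Psi(m)\Big).$$
   Context: A standard complex normal is a complex random variable with density $\pi^{-1}e^{-|z|^2}$ on $\mathbb{C}$ (so $\langle |z|^2\rangle = 1$). $\Psi(x) = \Gamma'(x)/\Gamma(x)$ is the digamma function. $\Sigma^{1/2}$ is the positive definite square root. Lyapunov exponents: for i.i.d. $d\times d$ random matrices $A_i$ such that the diagonal elements of $A_i^\dagger A_i$ have finite second moments, the limit $V_d := \lim_{N\to\infty}(P_N^\dagger P_N)^{1/(2N)}$, with $P_N = A_N\cdots A_1$, exists almost surely (Oseledec's multiplicative ergodic theorem) and has nonrandom positive eigenvalues, written $e^{\mu_1}\ge \cdots\ge e^{\mu_d}$; the numbers $\mu_1\ge\cdots\ge\mu_d$ are the Lyapunov exponents. *)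

theory Defs
  imports "HOL-Probability.Probability" "HOL-Computational_Algebra.Computational_Algebra"
begin

definition conj_transpose :: "complex^'n^'m \<Rightarrow> complex^'m^'n" where
  "conj_transpose A = (\<chi> i j. cnj (A $ j $ i))"

text \<open>On complex vectors, \<open>x \<bullet> y\<close> is the real part of the Hermitian inner product of \<open>x\<close> and
  \<open>y\<close>. For Hermitian \<open>A\<close> the Hermitian form of \<open>A\<close> at \<open>x\<close> is real, hence equal to
  \<open>x \<bullet> (A *v x)\<close>.\<close>

definition pos_def :: "complex^'n^'n \<Rightarrow> bool" where
  "pos_def A \<longleftrightarrow> conj_transpose A = A \<and> (\<forall>x. x \<noteq> 0 \<longrightarrow> 0 < x \<bullet> (A *v x))"

definition pos_semidef :: "complex^'n^'n \<Rightarrow> bool" where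
  "pos_semidef A \<longleftrightarrow> conj_transpose A = A \<and> (\<forall>x. 0 \<le> x \<bullet> (A *v x))"

definition pos_def_sqrt :: "complex^'n^'n \<Rightarrow> complex^'n^'n" where
  "pos_def_sqrt A = (THE B. pos_def B \<and> B ** B = A)"

text \<open>The operation \<open>^\<close> on type \<^typ>\<open>complex^'n^'n\<close> would be the entrywise power.\<close>

primrec matpow :: "complex^'n^'n \<Rightarrow> nat \<Rightarrow> complex^'n^'n" where
  "matpow A 0 = mat 1"
| "matpow A (Suc k) = A ** matpow A k"

text \<open>The power \<open>A\<^sup>1\<^sup>/\<^sup>k\<close> of a positive semidefinite matrix, for \<open>k \<ge> 1\<close>; it is positive
  definite if \<open>A\<close> is.\<close>

definition pos_semidef_root :: "nat \<Rightarrow> complex^'n^'n \<Rightarrow> complex^'n^'n" where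
  "pos_semidef_root k A = (THE B. pos_semidef B \<and> matpow B k = A)"

definition char_polynomial :: "complex^'n^'n \<Rightarrow> complex poly" where
  "char_polynomial A = det (\<chi> i j. (if i = j then [:0, 1:] else 0) - [:A $ i $ j:])"

text \<open>Eigenvalues counted with algebraic multiplicity.\<close>

definition eigenvalues :: "complex^'n^'n \<Rightarrow> complex multiset" where
  "eigenvalues A = proots (char_polynomial A)"

definition standard_complex_normal :: "'w measure \<Rightarrow> ('w \<Rightarrow> complex) \<Rightarrow> bool" where
  "standard_complex_normal M X \<longleftrightarrow>
     distributed M lborel X (\<lambda>z. ennreal (exp (- (cmod z)\<^sup>2) / pi))"

text \<open>\<open>matprod A N = A N ** \<dots> ** A 1\<close>; the value \<open>A 0\<close> plays no role.\<close>

primrec matprod :: "(nat \<Rightarrow> complex^'n^'n) \<Rightarrow> nat \<Rightarrow> complex^'n^'n" where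
  "matprod A 0 = mat 1"
| "matprod A (Suc N) = A (Suc N) ** matprod A N"

text \<open>\<open>\<mu> 1 \<ge> \<dots> \<ge> \<mu> d\<close>, with \<open>d = CARD('n)\<close>, are the Lyapunov exponents of the products
  \<open>P N = A N ** \<dots> ** A 1\<close>: almost surely, the \<open>2N\<close>-th roots of \<open>(P N)\<^sup>* ** P N\<close> converge to a
  matrix with the (nonrandom) eigenvalues \<open>exp (\<mu> 1), \<dots>, exp (\<mu> d)\<close>.\<close>

definition lyapunov_exponents ::
    "'w measure \<Rightarrow> (nat \<Rightarrow> 'w \<Rightarrow> complex^'n^'n) \<Rightarrow> (nat \<Rightarrow> real) \<Rightarrow> bool" where
  "lyapunov_exponents M A \<mu> \<longleftrightarrow>
     antimono_on {1..CARD('n)} \<mu> \<and>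
     (AE \<omega> in M. \<exists>V.
        (\<lambda>N. pos_semidef_root (2 * N)
               (conj_transpose (matprod (\<lambda>i. A i \<omega>) N) ** matprod (\<lambda>i. A i \<omega>) N)) \<longlonglongrightarrow> V \<and>
        eigenvalues V = image_mset (\<lambda>m. complex_of_real (exp (\<mu> m))) (mset_set {1..CARD('n)}))"

end

theory Submission
  imports Defs
begin

text \<open>The determinant turns the matrix product into a product of independent scalars. Write
  \<open>P N\<close> for the product of the first \<open>N\<close> factors. The unique positive semidefinite \<open>2N\<close>-th root of
  \<open>(P N)\<^sup>* ** P N\<close> has determinant \<open>\<bar>det (P N)\<bar> powr (1/N)\<close> (\<open>det_root_gram\<close>), and the determinant
  of the limit matrix \<open>V\<close> is the product of its eigenvalues (\<open>det_eq_prod_eigenvalues\<close>), that is,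
  \<open>exp (\<mu> 1 + \<dots> + \<mu> d)\<close>. Hence almost surely
  \<open>\<bar>det \<Sigma>\<bar> * (\<Prod>i=1..N. \<bar>det (G i)\<bar> powr (2/N))\<close> tends to \<open>exp (2 * (\<mu> 1 + \<dots> + \<mu> d))\<close>, and only the
  limit of the geometric means of \<open>\<bar>det (G i)\<bar>\<^sup>2\<close> has to be identified.

  This is done with moments, which avoids integrating logarithms. The Mellin transform
  of \<open>\<bar>det G\<bar>\<^sup>2\<close> is
  \<open>E (\<bar>det G\<bar> powr (2 * s)) = (\<Prod>m=1..d. Gamma (m + s) / Gamma m)\<close> (\<open>complex_gaussian_det_moment\<close>).
  By independence the first and second moments of the geometric mean of \<open>N\<close> factors are the \<open>N\<close>-th
  powers of this function at \<open>1/N\<close> and \<open>2/N\<close>. The logarithmic derivative of the function at \<open>0\<close> is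
  \<open>\<kappa> = (\<Sum>m=1..d. Digamma m)\<close>, so the two moments tend to \<open>exp \<kappa>\<close> and \<open>(exp \<kappa>)\<^sup>2\<close>. The
  variance thus tends to \<open>0\<close>, and a constant almost sure limit must be \<open>exp \<kappa>\<close>
  (\<open>AE_limit_eq_of_moments\<close>).

  The Mellin transform comes from the rotation invariance of the Gaussian law. Given one row \<open>x\<close>,
  a unitary reflection sends \<open>x\<close> to a multiple of a coordinate axis, of length \<open>norm x\<close>. Applied to
  all rows it leaves the modulus of the determinant and the law of the remaining rows unchanged, and
  the determinant becomes \<open>norm x\<close> times a Gaussian determinant of size one less
  (\<open>det_bordered_insert\<close>, \<open>det_bordered_moment\<close>). Each step contributes the \<open>s\<close>-th moment of a
  squared norm, which is a sum of independent exponential variables.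

  The roots are given by definite descriptions, so their existence and uniqueness must be shown; both
  rest on the spectral theorem in the form that eigenvectors of a Hermitian matrix span the space.\<close>

(* both formal power series and vectors use this symbol; here it always selects a component *)
no_notation fps_nth (infixl "$" 75)

section \<open>Hermitian matrices\<close>

text \<open>A maximiser of the quadratic form \<open>x \<bullet> f x\<close> on the unit sphere of \<open>W\<close> is an eigenvector, by the
  first order condition at the maximum.\<close>

lemma selfadjoint_has_eigenvector:
  fixes f :: "'a::euclidean_space \<Rightarrow> 'a"
  assumes "linear f" and adj: "\<And>x y. f x \<bullet> y = x \<bullet> f y"
    and W: "subspace W" "W \<noteq> {0}" and inv: "\<And>x. x \<in> W \<Longrightarrow> f x \<in> W"
  obtains v c where "v \<in> W" "v \<noteq> 0" "f v = c *\<^sub>R v"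
proof -
  interpret linear f by fact
  have cont: "continuous_on UNIV f"
    using \<open>linear f\<close> by (simp add: linear_continuous_on linear_linear)
  let ?K = "sphere 0 1 \<inter> W"
  have "compact ?K"
    by (intro compact_Int_closed compact_sphere closed_subspace W)
  moreover have "?K \<noteq> {}"
  proof -
    obtain w where "w \<in> W" "w \<noteq> 0"
      using W subspace_0 by blast
    then have "w /\<^sub>R norm w \<in> ?K"
      using W by (auto simp: subspace_scale)
    then show ?thesis by blast
  qed
  moreover have "continuous_on ?K (\<lambda>x. x \<bullet> f x)"
    by (intro continuous_intros continuous_on_subset[OF cont]) auto
  ultimately obtain v where v: "v \<in> ?K" and max: "\<And>x. x \<in> ?K \<Longrightarrow> x \<bullet> f x \<le> v \<bullet> f v"
    using continuous_attains_sup by metis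
  define c where "c = v \<bullet> f v"
  have vv: "v \<bullet> v = 1" using v by (simp add: norm_eq_1)
  define g where "g x = c * (x \<bullet> x) - x \<bullet> f x" for x
  have g_nonneg: "0 \<le> g x" if "x \<in> W" for x
  proof (cases "x = 0")
    case False
    then have "x /\<^sub>R norm x \<in> ?K"
      using that W by (auto simp: subspace_scale)
    from max[OF this] have "(x \<bullet> f x) / (norm x)\<^sup>2 \<le> c"
      by (simp add: c_def scale power2_eq_square divide_inverse mult_ac)
    then show ?thesis
      using False by (simp add: g_def divide_simps dot_square_norm mult_ac split: if_splits)
  qed (simp add: g_def)
  define w where "w = c *\<^sub>R v - f v"
  have w: "w \<in> W"
    using v W inv by (auto simp: w_def intro!: subspace_diff subspace_scale)
  \<comment> \<open>first order condition at the maximum: the quadratic polynomial \<open>t \<mapsto> g (v + t w)\<close> is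
    nonnegative and vanishes at \<open>0\<close>\<close>
  have quad: "0 \<le> 2 * t * (w \<bullet> w) + t\<^sup>2 * g w" for t
  proof -
    have "v + t *\<^sub>R w \<in> W"
      using v w W by (auto intro!: subspace_add subspace_scale)
    from g_nonneg[OF this] have "0 \<le> g (v + t *\<^sub>R w)" .
    also have "g (v + t *\<^sub>R w) = g v + 2 * t * (c * (v \<bullet> w) - f v \<bullet> w) + t\<^sup>2 * g w"
    proof -
      have "w \<bullet> f v = f v \<bullet> w" "v \<bullet> f w = f v \<bullet> w" "w \<bullet> v = v \<bullet> w"
        by (metis adj inner_commute)+
      then show ?thesis
        by (simp add: g_def add scale inner_add_left inner_add_right power2_eq_square)
           (simp add: algebra_simps)
    qed
    also have "g v = 0"
      using vv by (simp add: g_def c_def)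
    also have "c * (v \<bullet> w) - f v \<bullet> w = w \<bullet> w"
      by (simp add: w_def inner_diff_left)
    finally show ?thesis by simp
  qed
  have "w \<bullet> w = 0"
  proof (rule ccontr)
    assume "w \<bullet> w \<noteq> 0"
    then have a: "w \<bullet> w > 0" by simp
    have b: "0 \<le> g w" by (rule g_nonneg) fact
    \<comment> \<open>close to the minimiser of the quadratic polynomial; the \<open>+ 1\<close> keeps the denominator positive\<close>
    define t where "t = - (w \<bullet> w) / (g w + 1)"
    have "2 * t * (w \<bullet> w) + t\<^sup>2 * g w = ((w \<bullet> w) / (g w + 1))\<^sup>2 * (- 2 * (g w + 1) + g w)"
      using b by (simp add: t_def divide_simps power2_eq_square) (simp add: algebra_simps)
    also have "\<dots> < 0"
      using a b by (intro mult_pos_neg) auto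
    finally show False using quad[of t] by simp
  qed
  then have "f v = c *\<^sub>R v" by (simp add: w_def)
  with v that show thesis by (metis IntE norm_zero zero_neq_one mem_sphere_0)
qed

text \<open>The orthogonal complement of all eigenvectors is invariant, so if it were nonzero it would contain
  another eigenvector, orthogonal to itself.\<close>

lemma selfadjoint_eigenvectors_span:
  fixes f :: "'a::euclidean_space \<Rightarrow> 'a"
  assumes "linear f" and adj: "\<And>x y. f x \<bullet> y = x \<bullet> f y"
  shows "span {v. \<exists>c. f v = c *\<^sub>R v} = UNIV"
proof (rule ccontr)
  let ?E = "{v. \<exists>c. f v = c *\<^sub>R v}"
  let ?W = "{w. \<forall>v\<in>?E. w \<bullet> v = 0}"
  assume "span ?E \<noteq> UNIV"
  then have "span ?E \<subset> span UNIV" by auto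
  then obtain x where "x \<noteq> 0" "\<And>y. y \<in> span ?E \<Longrightarrow> orthogonal x y"
    by (rule orthogonal_to_subspace_exists_gen) blast
  then have "x \<in> ?W"
    by (auto simp: orthogonal_def span_base)
  then have ne: "?W \<noteq> {0}" using \<open>x \<noteq> 0\<close> by blast
  have sub: "subspace ?W"
    by (auto simp: subspace_def inner_add_left)
  have inv: "f w \<in> ?W" if "w \<in> ?W" for w
    using that by (auto simp: adj)
  obtain v c where v: "v \<in> ?W" "v \<noteq> 0" "f v = c *\<^sub>R v"
    by (rule selfadjoint_has_eigenvector[OF assms sub ne inv])
  have "\<forall>u\<in>?E. v \<bullet> u = 0" using v(1) by (rule CollectD)
  moreover have "v \<in> ?E" using v(3) by blast
  ultimately have "v \<bullet> v = 0" by (rule bspec)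
  with v(2) show False by simp
qed

lemma inner_complex_vec: "(x::complex^'n) \<bullet> y = Re (\<Sum>i\<in>UNIV. cnj (x $ i) * y $ i)"
  by (simp add: inner_vec_def inner_complex_def)

lemma inner_matrix_vector: "(x::complex^'m) \<bullet> (A *v y) = (conj_transpose A *v x) \<bullet> y"
proof -
  have "(\<Sum>i\<in>UNIV. cnj (x $ i) * (\<Sum>j\<in>UNIV. A $ i $ j * y $ j)) =
        (\<Sum>j\<in>UNIV. \<Sum>i\<in>UNIV. cnj (x $ i) * (A $ i $ j * y $ j))"
    unfolding sum_distrib_left by (rule sum.swap)
  also have "\<dots> = (\<Sum>j\<in>UNIV. cnj (\<Sum>i\<in>UNIV. cnj (A $ i $ j) * x $ i) * y $ j)"
    by (simp add: sum_distrib_left sum_distrib_right mult_ac)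
  finally show ?thesis
    by (simp add: inner_complex_vec matrix_vector_mult_def conj_transpose_def)
qed

lemma linear_complex_matrix_vector: "linear ((*v) (A :: complex^'n^'m))"
  by (rule linearI)
     (simp_all add: vec_eq_iff matrix_vector_mult_def algebra_simps sum.distrib scaleR_sum_right)

lemma conj_transpose_mult: "conj_transpose (A ** B) = conj_transpose B ** conj_transpose A"
  by (simp add: vec_eq_iff conj_transpose_def matrix_matrix_mult_def mult.commute)

lemma conj_transpose_invol: "conj_transpose (conj_transpose A) = A"
  by (simp add: vec_eq_iff conj_transpose_def)

lemma det_conj_transpose: "det (conj_transpose A) = cnj (det A)"
proof -
  have "conj_transpose A = transpose (\<chi> i j. cnj (A $ i $ j))"
    by (simp add: conj_transpose_def transpose_def)
  then have "det (conj_transpose A) = det (\<chi> i j. cnj (A $ i $ j))"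
    by simp
  also have "\<dots> = cnj (det A)"
    by (simp add: det_def)
  finally show ?thesis .
qed

lemma hermitian_eigenvectors_span:
  assumes "conj_transpose A = A"
  shows "span {v. \<exists>c::real. A *v v = c *\<^sub>R v} = UNIV"
  using selfadjoint_eigenvectors_span[OF linear_complex_matrix_vector[of A]]
    inner_matrix_vector[of _ A] assms by metis

text \<open>The spectral theorem as a proof rule: an identity between matrices may be checked on the eigenvectors
  of a single Hermitian matrix.\<close>

lemma matrix_eq_on_eigenvectors:
  fixes A B C :: "complex^'n^'n"
  assumes "conj_transpose A = A"
    and "\<And>v c. A *v v = (c::real) *\<^sub>R v \<Longrightarrow> B *v v = C *v v"
  shows "B = C"
  unfolding matrix_eq
proof
  fix x
  show "B *v x = C *v x"
    by (rule linear_eq_on[OF linear_complex_matrix_vector linear_complex_matrix_vector,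
          where B = "{v. \<exists>c::real. A *v v = c *\<^sub>R v}"])
       (use assms hermitian_eigenvectors_span[OF assms(1)] in auto)
qed

text \<open>Eigenvectors for different eigenvalues are orthogonal, hence linearly independent.\<close>

lemma finite_real_eigenvalues:
  assumes "conj_transpose (A::complex^'n^'n) = A"
  shows "finite {c::real. \<exists>v\<noteq>0. A *v v = c *\<^sub>R v}" (is "finite ?L")
proof -
  have "\<forall>c\<in>?L. \<exists>v. v \<noteq> 0 \<and> A *v v = c *\<^sub>R v" by blast
  from bchoice[OF this] obtain v where v: "\<And>c. c \<in> ?L \<Longrightarrow> v c \<noteq> 0 \<and> A *v v c = c *\<^sub>R v c"
    by blast
  have orth: "v c \<bullet> v d = 0" if "c \<in> ?L" "d \<in> ?L" "c \<noteq> d" for c d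
  proof -
    have "v c \<bullet> (A *v v d) = (A *v v c) \<bullet> v d"
      using inner_matrix_vector[of "v c" A "v d"] assms by simp
    then have "d * (v c \<bullet> v d) = c * (v c \<bullet> v d)"
      using v[OF that(1)] v[OF that(2)] by simp
    with that show ?thesis by simp
  qed
  have "pairwise orthogonal (v ` ?L)"
    using orth by (auto simp: pairwise_def orthogonal_def)
  moreover have "0 \<notin> v ` ?L" using v by (metis (no_types, lifting) imageE)
  ultimately have "finite (v ` ?L)"
    using pairwise_orthogonal_independent independent_bound by blast
  moreover have "inj_on v ?L"
  proof (rule inj_onI)
    fix c d assume "c \<in> ?L" "d \<in> ?L" "v c = v d"
    then show "c = d" using orth[of c d] v[of c] by auto
  qed
  ultimately show ?thesis by (rule finite_imageD)
qed

lemma real_interpolation_exists: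
  fixes f :: "real \<Rightarrow> real"
  assumes "finite L"
  shows "\<exists>p. \<forall>c\<in>L. poly p c = f c"
  using assms
proof (induction L)
  case (insert a L)
  then obtain p where p: "\<forall>c\<in>L. poly p c = f c" by blast
  define q where "q = (\<Prod>c\<in>L. [:-c, 1:])"
  have q: "poly q c = 0" if "c \<in> L" for c
    using that insert by (auto simp: q_def poly_prod prod_zero_iff)
  have qa: "poly q a \<noteq> 0"
    using insert by (auto simp: q_def poly_prod prod_zero_iff)
  have "\<forall>c\<in>insert a L. poly (p + smult ((f a - poly p a) / poly q a) q) c = f c"
    using p q qa by auto
  then show ?case by blast
qed auto

lemma matpow_eigenvector:
  fixes c :: real
  assumes "A *v v = c *\<^sub>R v"
  shows "matpow A k *v v = c ^ k *\<^sub>R v"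
proof (induction k)
  case (Suc k)
  have "matpow A (Suc k) *v v = A *v (c ^ k *\<^sub>R v)"
    using Suc by (simp add: matrix_vector_mul_assoc[symmetric])
  also have "\<dots> = c ^ k *\<^sub>R (A *v v)"
    by (rule linear_scale[OF linear_complex_matrix_vector])
  finally show ?case using assms by simp
qed simp

lemma matpow_commute: "A ** matpow A k = matpow A k ** A"
  by (induction k) (simp_all add: matrix_mul_assoc)

lemma conj_transpose_matpow:
  "conj_transpose A = A \<Longrightarrow> conj_transpose (matpow A k) = matpow A k"
  by (induction k)
     (simp_all add: conj_transpose_mult matpow_commute, simp add: vec_eq_iff conj_transpose_def mat_def)

lemma det_matpow: "det (matpow A k) = det A ^ k"
  by (induction k) (simp_all add: det_mul)

text \<open>\<open>B\<close> is \<open>f(A)\<close>. It is obtained as a real polynomial in \<open>A\<close> that interpolates \<open>f\<close> on the finite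
  set of eigenvalues; real coefficients keep it Hermitian.\<close>

lemma hermitian_functional_calculus:
  fixes f :: "real \<Rightarrow> real"
  assumes A: "conj_transpose (A::complex^'n^'n) = A"
  obtains B where "conj_transpose B = B" "\<And>v c. A *v v = c *\<^sub>R v \<Longrightarrow> B *v v = f c *\<^sub>R v"
proof -
  obtain p where p: "\<And>c v. v \<noteq> 0 \<Longrightarrow> A *v v = c *\<^sub>R v \<Longrightarrow> poly p c = f c"
    using real_interpolation_exists[OF finite_real_eigenvalues[OF A], of f] by auto
  define B where "B = (\<Sum>j\<le>degree p. coeff p j *\<^sub>R matpow A j)"
  have "conj_transpose B = B"
  proof -
    \<comment> \<open>powers of \<open>A\<close> are Hermitian, here read entrywise\<close>
    have "cnj (matpow A j $ b $ a) = matpow A j $ a $ b" for j a b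
      using arg_cong[OF conj_transpose_matpow[OF A, of j], of "\<lambda>M. M $ a $ b"]
      by (simp add: conj_transpose_def)
    then show ?thesis by (simp add: vec_eq_iff conj_transpose_def B_def)
  qed
  moreover have "B *v v = f c *\<^sub>R v" if v: "A *v v = c *\<^sub>R v" for v c
  proof (cases "v = 0")
    case False
    have "B *v v = (\<Sum>j\<le>degree p. coeff p j *\<^sub>R (matpow A j *v v))"
      by (simp add: vec_eq_iff B_def matrix_vector_mult_def sum_distrib_right scaleR_sum_right
          sum.swap[of _ UNIV])
    also have "\<dots> = (\<Sum>j\<le>degree p. coeff p j * c ^ j) *\<^sub>R v"
      by (simp add: matpow_eigenvector[OF v] scaleR_sum_left)
    also have "\<dots> = f c *\<^sub>R v"
      using p[OF False v] by (simp add: poly_altdef)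
    finally show ?thesis .
  qed simp
  ultimately show thesis using that by blast
qed

lemma pos_semidef_square:
  assumes "conj_transpose C = C"
  shows "pos_semidef (C ** C)"
  using assms inner_matrix_vector[of _ C "C *v _"]
  by (auto simp: pos_semidef_def conj_transpose_mult matrix_vector_mul_assoc[symmetric])

lemma pos_semidef_eigenvalue_nonneg:
  assumes "pos_semidef A" "A *v v = (c::real) *\<^sub>R v" "v \<noteq> 0"
  shows "0 \<le> c"
proof -
  have "0 \<le> c * (v \<bullet> v)" using assms by (metis inner_scaleR_right pos_semidef_def)
  moreover have "0 < v \<bullet> v" using assms by simp
  ultimately show ?thesis by (simp add: zero_le_mult_iff)
qed

text \<open>The root is produced as the square of a Hermitian matrix \<open>C\<close>, the \<open>2k\<close>-th root of \<open>A\<close>. This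
  makes its positivity evident, and the same \<open>C\<close> later shows that determinants of positive
  semidefinite matrices are nonnegative.\<close>

lemma pos_semidef_root_exists:
  assumes A: "pos_semidef A" and k: "k \<ge> 1"
  shows "\<exists>C. conj_transpose C = C \<and> pos_semidef (C ** C) \<and> matpow (C ** C) k = A"
proof -
  have herm: "conj_transpose A = A" using A by (simp add: pos_semidef_def)
  obtain C where C: "conj_transpose C = C"
    "\<And>v c. A *v v = c *\<^sub>R v \<Longrightarrow> C *v v = root (2 * k) c *\<^sub>R v"
    using hermitian_functional_calculus[OF herm] by metis
  have "matpow (C ** C) k = A"
  proof (rule matrix_eq_on_eigenvectors[OF herm])
    fix v and c :: real assume v: "A *v v = c *\<^sub>R v"
    have "(C ** C) *v v = (root (2 * k) c)\<^sup>2 *\<^sub>R v"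
      using C(2)[OF v] linear_scale[OF linear_complex_matrix_vector[of C]]
      by (simp add: matrix_vector_mul_assoc[symmetric] power2_eq_square)
    from matpow_eigenvector[OF this, of k] 
    have "matpow (C ** C) k *v v = (root (2 * k) c) ^ (2 * k) *\<^sub>R v"
      by (simp add: power_mult)
    moreover have "v = 0 \<or> root (2 * k) c ^ (2 * k) = c"
      using pos_semidef_eigenvalue_nonneg[OF A v] real_root_pow_pos2[of "2 * k" c] k by force
    ultimately show "matpow (C ** C) k *v v = A *v v"
      using v by auto
  qed
  with C(1) pos_semidef_square show ?thesis by blast
qed

text \<open>If \<open>C v = c v\<close> and \<open>B w = b w\<close>, then \<open>b ^ k * (w \<bullet> v) = w \<bullet> (B\<^sup>k v) = c ^ k * (w \<bullet> v)\<close>, so that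
  \<open>w\<close> is orthogonal to \<open>v\<close> or \<open>b = c\<close>. In both cases \<open>w\<close> is orthogonal to \<open>B v - c v\<close>; since the
  eigenvectors \<open>w\<close> of \<open>B\<close> span the space, \<open>B v = c v\<close>.\<close>

lemma pos_semidef_root_unique:
  assumes B: "pos_semidef B" and C: "pos_semidef C" and eq: "matpow B k = matpow C k" and k: "k \<ge> 1"
  shows "B = C"
proof -
  have hB: "conj_transpose B = B" and hC: "conj_transpose C = C"
    using B C by (auto simp: pos_semidef_def)
  show ?thesis
  proof (rule matrix_eq_on_eigenvectors[OF hC])
    fix v and c :: real assume v: "C *v v = c *\<^sub>R v"
    have "x \<bullet> (B *v v - C *v v) = 0" for x
    proof (rule linear_eq_on[where f = "\<lambda>w. w \<bullet> (B *v v - C *v v)" and g = "\<lambda>w. 0" and B = "{w. \<exists>b::real. B *v w = b *\<^sub>R w}"])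
      fix w assume "w \<in> {w. \<exists>b::real. B *v w = b *\<^sub>R w}"
      then obtain b :: real where w: "B *v w = b *\<^sub>R w" by blast
      show "w \<bullet> (B *v v - C *v v) = 0"
      proof (cases "w = 0 \<or> v = 0")
        case False
        have nn: "0 \<le> b" "0 \<le> c"
          using pos_semidef_eigenvalue_nonneg[OF B w] pos_semidef_eigenvalue_nonneg[OF C v] False
          by auto
        have "w \<bullet> (matpow B k *v v) = (matpow B k *v w) \<bullet> v"
          using inner_matrix_vector conj_transpose_matpow[OF hB] by metis
        then have "c ^ k * (w \<bullet> v) = b ^ k * (w \<bullet> v)"
          by (simp add: matpow_eigenvector[OF w]) (simp add: eq matpow_eigenvector[OF v])
        then have "w \<bullet> v = 0 \<or> c = b"
          using nn k power_eq_iff_eq_base[of k c b] by auto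
        moreover have "w \<bullet> (B *v v) = b * (w \<bullet> v)"
          using inner_matrix_vector[of w B v] hB w by simp
        ultimately show ?thesis
          using v by (auto simp: inner_diff_right)
      qed (auto simp: matrix_vector_mult_0_right)
    qed (use hermitian_eigenvectors_span[OF hB] in
        \<open>auto intro!: linearI simp: inner_add_left\<close>)
    from this[of "B *v v - C *v v"] show "B *v v = C *v v" by simp
  qed
qed

lemma pos_semidef_root_eq:
  assumes "pos_semidef A" "k \<ge> 1"
  shows "pos_semidef (pos_semidef_root k A) \<and> matpow (pos_semidef_root k A) k = A"
  unfolding pos_semidef_root_def
  by (rule theI') (use pos_semidef_root_exists[OF assms] pos_semidef_root_unique assms in metis)

text \<open>A Hermitian square root of \<open>A\<close> has a real determinant, and \<open>det A\<close> is its square.\<close>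

lemma pos_semidef_det:
  assumes "pos_semidef A"
  shows "det A = of_real (cmod (det A))"
proof -
  obtain C where C: "conj_transpose C = C" "C ** C = A"
    using pos_semidef_root_exists[OF assms, of 1] by auto
  have "cnj (det C) = det C" using det_conj_transpose[of C] C by simp
  then have "det C = of_real (Re (det C))" by (simp add: complex_eq_iff)
  moreover define r where "r = Re (det C)"
  ultimately have "det A = of_real (r * r)"
    using det_mul[of C C] C(2) by simp
  then show ?thesis by (simp add: norm_mult)
qed

lemma pos_semidef_gram: "pos_semidef (conj_transpose P ** P)"
  using inner_matrix_vector[of _ "conj_transpose P" "P *v _"]
  by (auto simp: pos_semidef_def conj_transpose_mult conj_transpose_invol
      matrix_vector_mul_assoc[symmetric])

text \<open>The determinant \<open>r\<close> of the root satisfies \<open>r ^ (2 * N) = (cmod (det P))\<^sup>2\<close>, and \<open>r \<ge> 0\<close> since the root is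
  positive semidefinite.\<close>

lemma det_root_gram:
  fixes P :: "complex^'n^'n"
  assumes "N \<ge> 1"
  shows "det (pos_semidef_root (2 * N) (conj_transpose P ** P)) = of_real (cmod (det P) powr (1 / N))"
proof -
  let ?R = "pos_semidef_root (2 * N) (conj_transpose P ** P)"
  have R: "pos_semidef ?R" "matpow ?R (2 * N) = conj_transpose P ** P"
    using pos_semidef_root_eq[OF pos_semidef_gram, of "2 * N" P] assms by auto
  have "cmod (det ?R) ^ (2 * N) = cmod (det P) ^ 2"
    using arg_cong[OF R(2), of "\<lambda>M. cmod (det M)"]
    by (simp add: det_matpow det_mul det_conj_transpose norm_mult norm_power power2_eq_square)
  then have "(cmod (det ?R) ^ N)^2 = cmod (det P)^2"
    by (simp add: power_mult[symmetric] mult.commute)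
  then have eq: "cmod (det ?R) ^ N = cmod (det P)"
    by (simp add: power2_eq_iff_nonneg)
  have "cmod (det ?R) = root N (cmod (det P))"
    unfolding eq[symmetric] using assms by (simp add: real_root_power_cancel)
  also have "\<dots> = cmod (det P) powr (1 / N)"
    using assms by (cases "det P = 0") (auto simp: root_powr_inverse)
  finally show ?thesis using pos_semidef_det[OF R(1)] by simp
qed

lemma pos_def_imp_det_nonzero:
  assumes "pos_def A" shows "det A \<noteq> 0"
proof -
  have "x = 0" if "A *v x = 0" for x
    using assms that by (metis inner_zero_right less_irrefl pos_def_def)
  then have "inj ((*v) A)" by (simp add: vec.inj_iff_eq_0)
  then show ?thesis
    using matrix_left_invertible_injective[of A] invertible_left_inverse[of A] invertible_det_nz[of A]
    by simp
qed

lemma pos_def_imp_pos_semidef: "pos_def A \<Longrightarrow> pos_semidef A"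
  by (metis inner_zero_left less_eq_real_def order_refl pos_def_def pos_semidef_def)

lemma matpow_2: "matpow A 2 = A ** A"
  by (simp add: numeral_2_eq_2)

text \<open>The semidefinite square root has the form \<open>C ** C\<close> with \<open>C\<close> Hermitian. It is definite because
  \<open>det C \<noteq> 0\<close>, so that \<open>C\<close> is injective.\<close>

lemma pos_def_sqrt_square:
  assumes A: "pos_def A"
  shows "pos_def_sqrt A ** pos_def_sqrt A = A"
proof -
  obtain C where C: "conj_transpose C = C" "pos_semidef (C ** C)" "matpow (C ** C) 2 = A"
    using pos_semidef_root_exists[OF pos_def_imp_pos_semidef[OF A], of 2] by auto
  have "det C ^ 4 = det A"
    using C(3) by (auto simp: matpow_2 det_mul power_numeral_reduce)
  then have "det C \<noteq> 0" using pos_def_imp_det_nonzero[OF A] by auto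
  then have "inj ((*v) C)"
    using matrix_left_invertible_injective invertible_left_inverse invertible_det_nz by blast
  then have "C *v x \<noteq> 0" if "x \<noteq> 0" for x
    using that vec.inj_iff_eq_0[of C] by blast
  then have "pos_def (C ** C)"
    using C(1) inner_matrix_vector[of _ C "C *v _"]
    by (auto simp: pos_def_def conj_transpose_mult matrix_vector_mul_assoc[symmetric])
  with C(3) have "pos_def (C ** C) \<and> (C ** C) ** (C ** C) = A"
    by (simp add: matpow_2)
  moreover have "B = D" if "pos_def B \<and> B ** B = A" "pos_def D \<and> D ** D = A" for B D
    using that pos_semidef_root_unique[of B D 2] by (simp add: matpow_2 pos_def_imp_pos_semidef)
  ultimately have "\<exists>!B. pos_def B \<and> B ** B = A" by blast
  then show ?thesis unfolding pos_def_sqrt_def using theI'[of "\<lambda>B. pos_def B \<and> B ** B = A"] by blast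
qed

section \<open>Eigenvalues and the determinant\<close>

lemma poly_det: "poly (det M) x = det (\<chi> i j. poly (M $ i $ j) x)"
  by (simp add: det_def poly_sum poly_prod)

text \<open>In the expansion over permutations only the identity contributes a product of \<open>CARD('n)\<close> linear
  factors; every other permutation meets a constant entry.\<close>

lemma char_polynomial_monic:
  fixes A :: "complex^'n^'n"
  shows "degree (char_polynomial A) = CARD('n)" "lead_coeff (char_polynomial A) = 1"
proof -
  let ?n = "CARD('n)"
  define M where "M = (\<chi> i j. (if i = j then [:0, 1:] else 0) - [:A $ i $ j:])"
  define T where "T p = of_int (sign p) * (\<Prod>i\<in>UNIV. M $ i $ p i)" for p
  have entry: "M $ i $ j = (if i = j then [:- (A $ i $ i), 1:] else [:- (A $ i $ j):])" for i j
    by (auto simp: M_def)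
  have small: "degree (T p) < ?n" if p: "p \<noteq> id" for p :: "'n \<Rightarrow> 'n"
  proof -
    obtain a where a: "p a \<noteq> a" using p by (metis eq_id_iff)
    have "degree (T p) \<le> degree (\<Prod>i\<in>UNIV. M $ i $ p i)"
      unfolding T_def by (cases "sign p = 1") (auto simp: sign_def)
    also have "\<dots> \<le> (\<Sum>i\<in>UNIV. degree (M $ i $ p i))"
      using degree_prod_sum_le[of UNIV "\<lambda>i. M $ i $ p i"] by simp
    also have "\<dots> < (\<Sum>i\<in>(UNIV::'n set). 1)"
      by (rule sum_strict_mono_ex1) (use a[symmetric] in \<open>auto simp: entry\<close>)
    finally show ?thesis by simp
  qed
  have "char_polynomial A = (\<Sum>p\<in>{p. p permutes UNIV}. T p)"
    by (simp add: char_polynomial_def det_def T_def M_def)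
  also have "\<dots> = T id + (\<Sum>p\<in>{p. p permutes UNIV} - {id}. T p)"
    by (subst sum.remove[of _ id]) (auto simp: permutes_id finite_permutations)
  finally have split: "char_polynomial A = T id + (\<Sum>p\<in>{p. p permutes UNIV} - {id}. T p)" .
  have rest: "degree (\<Sum>p\<in>{p. p permutes UNIV} - {id}. T p) < ?n"
    by (rule degree_sum_less) (auto intro: small)
  have Tid: "T id = (\<Prod>i\<in>UNIV. [:- (A $ i $ i), 1:])"
    by (simp add: T_def entry sign_id)
  have dT: "degree (T id) = ?n"
    unfolding Tid by (subst degree_prod_sum_eq) auto
  have lT: "lead_coeff (T id) = 1"
    unfolding Tid lead_coeff_prod by simp
  show d: "degree (char_polynomial A) = ?n"
    unfolding split using rest dT degree_add_eq_left by metis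
  show "lead_coeff (char_polynomial A) = 1"
    unfolding d unfolding split using rest lT dT by (simp add: coeff_eq_0)
qed

text \<open>Both sides are, up to the same sign, the value at \<open>0\<close> of the characteristic polynomial, which is
  monic and splits over the complex numbers.\<close>

lemma det_eq_prod_eigenvalues:
  fixes A :: "complex^'n^'n"
  shows "det A = prod_mset (eigenvalues A)"
proof -
  let ?p = "char_polynomial A"
  have p: "?p = (\<Prod>x\<in>#eigenvalues A. [:- x, 1:])"
    using complex_poly_decompose_multiset[of ?p] char_polynomial_monic(2)[of A]
    by (simp add: eigenvalues_def)
  have "poly ?p 0 = (\<Prod>x\<in>#eigenvalues A. - x)"
    unfolding p by (simp add: poly_prod_mset)
  also have "\<dots> = (-1) ^ size (eigenvalues A) * prod_mset (eigenvalues A)"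
  proof -
    have "(\<Prod>x\<in>#E. - x) = (-1) ^ size E * prod_mset E" for E :: "complex multiset"
      by (induction E) auto
    then show ?thesis .
  qed
  also have "size (eigenvalues A) = CARD('n)"
    by (simp add: eigenvalues_def size_proots_complex char_polynomial_monic)
  finally have "poly ?p 0 = (-1) ^ CARD('n) * prod_mset (eigenvalues A)" .
  moreover have "poly ?p 0 = det (\<chi> i. (-1) *s (A $ i))"
    unfolding char_polynomial_def poly_det
    by (rule arg_cong[where f = det]) (auto simp: vec_eq_iff)
  moreover have "\<dots> = (-1) ^ CARD('n) * det A"
    by (subst det_rows_mul) simp
  ultimately show ?thesis by simp
qed

section \<open>Complex Gaussian vectors\<close>

text \<open>Uniqueness of a translation invariant measure, proved directly. Let \<open>V\<close> be the volume of the unit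
  ball. The double integral of \<open>1\<^sub>B(y) f(T x + y)\<close>, with \<open>B\<close> the unit ball, equals \<open>V\<close> times the
  integral of \<open>f \<circ> T\<close> when \<open>x\<close> is integrated first, because \<open>x\<close> can be translated to absorb \<open>y\<close>. It
  equals \<open>V\<close> times the integral of \<open>f\<close> when \<open>y\<close> is translated by \<open>T x\<close>, because the preimage under
  \<open>T\<close> of a unit ball is a unit ball.\<close>

lemma nn_integral_lborel_orthogonal:
  fixes T :: "'a::euclidean_space \<Rightarrow> 'a" and f :: "'a \<Rightarrow> ennreal"
  assumes T: "orthogonal_transformation T" and f[measurable]: "f \<in> borel_measurable borel"
  shows "(\<integral>\<^sup>+x. f (T x) \<partial>lborel) = (\<integral>\<^sup>+x. f x \<partial>lborel)"
proof -
  interpret T: linear T using T by (rule orthogonal_transformation_linear)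
  have [measurable]: "T \<in> borel_measurable borel"
    using orthogonal_transformation_linear[OF T]
    by (intro borel_measurable_continuous_onI) (simp add: linear_continuous_on linear_linear)
  obtain T' where T': "\<And>y. T (T' y) = y"
    using orthogonal_transformation_surj[OF T] by (metis surjD)
  have shift: "(\<integral>\<^sup>+x. h (x + c) \<partial>lborel) = (\<integral>\<^sup>+x. h x \<partial>lborel)"
    if [measurable]: "h \<in> borel_measurable borel" for h :: "'a \<Rightarrow> ennreal" and c
    by (subst (2) lborel_distr_plus[of c, symmetric], subst nn_integral_distr) (auto simp: add.commute)
  define g :: "'a \<Rightarrow> ennreal" where "g = indicator (ball 0 1)"
  have [measurable]: "g \<in> borel_measurable borel"
    unfolding g_def by (intro borel_measurable_indicator) simp
  define V where "V = emeasure lborel (ball (0::'a) 1)"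
  have V: "V \<noteq> 0" "V \<noteq> \<infinity>"
    using unit_ball_vol_pos[of "real DIM('a)"] by (auto simp: V_def emeasure_ball less_le)
  have g: "(\<integral>\<^sup>+y. g y \<partial>lborel) = V"
    by (simp add: g_def V_def)
  have gT: "(\<integral>\<^sup>+x. g (y - T x) \<partial>lborel) = V" for y
  proof -
    have "g (y - T x) = indicator (ball (T' y) 1) x" for x
    proof -
      have "norm (y - T x) = norm (T (T' y - x))"
        by (simp add: T.diff T')
      also have "\<dots> = dist (T' y) x"
        using T by (simp add: orthogonal_transformation_norm dist_norm)
      finally show ?thesis by (simp add: g_def indicator_def)
    qed
    then have "(\<integral>\<^sup>+x. g (y - T x) \<partial>lborel) = emeasure lborel (ball (T' y) 1)"
      by simp
    also have "\<dots> = V"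
      by (simp add: V_def emeasure_ball)
    finally show ?thesis .
  qed
  have "(\<integral>\<^sup>+x. f (T x) \<partial>lborel) * V = (\<integral>\<^sup>+y. g y * (\<integral>\<^sup>+x. f (T x) \<partial>lborel) \<partial>lborel)"
    by (simp add: nn_integral_multc g mult.commute)
  also have "\<dots> = (\<integral>\<^sup>+y. g y * (\<integral>\<^sup>+x. f (T x + y) \<partial>lborel) \<partial>lborel)"
  proof -
    have "(\<integral>\<^sup>+x. f (T x) \<partial>lborel) = (\<integral>\<^sup>+x. f (T x + y) \<partial>lborel)" for y
      using shift[of "\<lambda>x. f (T x)" "T' y"] by (simp add: T.add T')
    then show ?thesis by simp
  qed
  also have "\<dots> = (\<integral>\<^sup>+y. \<integral>\<^sup>+x. g y * f (T x + y) \<partial>lborel \<partial>lborel)"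
    by (simp add: nn_integral_cmult)
  also have "\<dots> = (\<integral>\<^sup>+x. \<integral>\<^sup>+y. g y * f (T x + y) \<partial>lborel \<partial>lborel)"
    by (rule lborel_pair.Fubini') measurable
  also have "\<dots> = (\<integral>\<^sup>+x. \<integral>\<^sup>+y. g (y - T x) * f y \<partial>lborel \<partial>lborel)"
  proof (rule nn_integral_cong)
    fix x
    show "(\<integral>\<^sup>+y. g y * f (T x + y) \<partial>lborel) = (\<integral>\<^sup>+y. g (y - T x) * f y \<partial>lborel)"
      using shift[of "\<lambda>y. g (y - T x) * f y" "T x"] by (simp add: add.commute)
  qed
  also have "\<dots> = (\<integral>\<^sup>+y. \<integral>\<^sup>+x. g (y - T x) * f y \<partial>lborel \<partial>lborel)"
    by (rule lborel_pair.Fubini') measurable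
  also have "\<dots> = (\<integral>\<^sup>+y. f y \<partial>lborel) * V"
    by (simp add: nn_integral_multc gT mult.commute[of V])
  finally show ?thesis
    using V by (metis infinity_ennreal_def mult_divide_eq_ennreal)
qed

definition cgauss :: "complex measure" where
  "cgauss = density lborel (\<lambda>z. ennreal (exp (- (cmod z)\<^sup>2) / pi))"

lemma sets_cgauss [measurable_cong, simp]: "sets cgauss = sets borel"
  by (simp add: cgauss_def)

lemma space_cgauss [simp]: "space cgauss = UNIV"
  by (simp add: cgauss_def)

text \<open>Polar coordinates without the angle: the disc \<open>(cmod z)\<^sup>2 \<le> t\<close> has area \<open>pi * t\<close>.\<close>

lemma distr_lborel_cmod_sq:
  "distr lborel borel (\<lambda>z. (cmod z)\<^sup>2) = density lborel (\<lambda>r. ennreal pi * indicator {0..} r)"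
  (is "?L = ?R")
proof (rule measure_eqI_generator_eq[where E = "range atMost" and \<Omega> = UNIV and A = "\<lambda>n. {..real n}"])
  have L: "emeasure ?L {..t} = ennreal (if t < 0 then 0 else pi * t)" for t
  proof -
    have "emeasure ?L {..t} = emeasure lborel {z. (cmod z)\<^sup>2 \<le> t}"
      by (subst emeasure_distr) (auto simp: vimage_def)
    also have "\<dots> = ennreal (if t < 0 then 0 else pi * t)"
    proof (cases "t < 0")
      case True
      then have "{z. (cmod z)\<^sup>2 \<le> t} = {}"
        by (auto simp: not_le intro: less_le_trans)
      with True show ?thesis by simp
    next
      case False
      have eq: "(cmod z)\<^sup>2 \<le> t \<longleftrightarrow> cmod z \<le> sqrt t" for z
        by (metis real_sqrt_abs abs_norm_cancel real_sqrt_le_iff)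
      then have "{z. (cmod z)\<^sup>2 \<le> t} = cball 0 (sqrt t)"
        by (simp only: set_eq_iff mem_Collect_eq mem_cball_0 eq simp_thms)
      then show ?thesis
        using False by (simp add: emeasure_cball unit_ball_vol_2)
    qed
    finally show ?thesis .
  qed
  have R: "emeasure ?R {..t} = ennreal (if t < 0 then 0 else pi * t)" for t
  proof -
    have "emeasure ?R {..t} = (\<integral>\<^sup>+r. ennreal pi * indicator {0..t} r \<partial>lborel)"
      by (subst emeasure_density) (auto intro!: nn_integral_cong simp: indicator_def)
    also have "\<dots> = ennreal pi * emeasure lborel {0..t}"
      by (subst nn_integral_cmult_indicator) auto
    also have "\<dots> = ennreal (if t < 0 then 0 else pi * t)"
      by (auto simp: ennreal_mult)
    finally show ?thesis .
  qed
  show "emeasure ?L X = emeasure ?R X" if "X \<in> range atMost" for X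
    using that L R by auto
  show "emeasure ?L {..real n} \<noteq> \<infinity>" for n by (simp add: L)
  show "sets ?L = sigma_sets UNIV (range atMost)" "sets ?R = sigma_sets UNIV (range atMost)"
    by (simp_all add: borel_eq_atMost)
  show "(\<Union>n. {..real n}) = UNIV"
    by (auto intro: real_arch_simple)
qed (auto simp: Int_stable_def)

lemma distr_cgauss_cmod_sq:
  "distr cgauss borel (\<lambda>z. (cmod z)\<^sup>2) = density lborel (exponential_density 1)"
proof (rule measure_eqI)
  fix A assume "A \<in> sets (distr cgauss borel (\<lambda>z. (cmod z)\<^sup>2))"
  then have [measurable]: "A \<in> sets borel" by simp
  have "emeasure (distr cgauss borel (\<lambda>z. (cmod z)\<^sup>2)) A =
        (\<integral>\<^sup>+z. indicator A ((cmod z)\<^sup>2) \<partial>cgauss)"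
    by (subst nn_integral_indicator[symmetric], simp, subst nn_integral_distr) auto
  also have "\<dots> = (\<integral>\<^sup>+z. ennreal (exp (- (cmod z)\<^sup>2) / pi) * indicator A ((cmod z)\<^sup>2) \<partial>lborel)"
    unfolding cgauss_def by (subst nn_integral_density) auto
  also have "\<dots> = (\<integral>\<^sup>+r. ennreal (exp (- r) / pi) * indicator A r \<partial>distr lborel borel (\<lambda>z::complex. (cmod z)\<^sup>2))"
    by (subst nn_integral_distr) auto
  also have "\<dots> = (\<integral>\<^sup>+r. (ennreal pi * indicator {0..} r) * (ennreal (exp (- r) / pi) * indicator A r) \<partial>lborel)"
    unfolding distr_lborel_cmod_sq by (subst nn_integral_density) auto
  also have "\<dots> = (\<integral>\<^sup>+r. ennreal (exponential_density 1 r) * indicator A r \<partial>lborel)"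
    by (intro nn_integral_cong)
       (auto simp: exponential_density_def indicator_def ennreal_mult[symmetric])
  also have "\<dots> = emeasure (density lborel (exponential_density 1)) A"
    by (subst emeasure_density) auto
  finally show "emeasure (distr cgauss borel (\<lambda>z. (cmod z)\<^sup>2)) A =
    emeasure (density lborel (exponential_density 1)) A" .
qed simp

lemma prob_space_cgauss: "prob_space cgauss"
proof -
  interpret D: prob_space "distr cgauss borel (\<lambda>z. (cmod z)\<^sup>2)"
    unfolding distr_cgauss_cmod_sq by (rule prob_space_exponential_density) simp
  show ?thesis
    using D.emeasure_space_1 by (intro prob_spaceI) (simp add: emeasure_distr)
qed

text \<open>The joint law of independent standard complex normals, given by its density because rotation
  invariance is visible there; \<open>distr_PiM_cgauss\<close> below is the description by independent
  coordinates.\<close>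

definition cgauss_vec :: "(complex^'n) measure" where
  "cgauss_vec = density lborel (\<lambda>x. ennreal (exp (- (norm x)\<^sup>2) / pi ^ CARD('n)))"

lemma sets_cgauss_vec [measurable_cong, simp]: "sets cgauss_vec = sets borel"
  by (simp add: cgauss_vec_def)

lemma space_cgauss_vec [simp]: "space cgauss_vec = UNIV"
  by (simp add: cgauss_vec_def)

lemma measurable_vec_lambda [measurable]:
  fixes f :: "'a \<Rightarrow> 'n::finite \<Rightarrow> 'b::euclidean_space"
  assumes "\<And>j. (\<lambda>x. f x j) \<in> borel_measurable M"
  shows "(\<lambda>x. \<chi> j. f x j) \<in> borel_measurable M"
proof (rule borel_measurable_euclidean_space[THEN iffD2], rule ballI)
  fix b :: "'b^'n" assume "b \<in> Basis"
  then obtain j c where "b = axis j c" by (auto simp: Basis_vec_def)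
  then show "(\<lambda>x. (\<chi> j. f x j) \<bullet> b) \<in> borel_measurable M"
    using assms by (simp add: inner_axis)
qed

lemma measurable_vec_nth [measurable]:
  "(\<lambda>x :: 'b::euclidean_space^'n. x $ j) \<in> borel_measurable borel"
  by (intro borel_measurable_continuous_onI continuous_intros)

lemma prod_Basis_vec:
  "(\<Prod>b\<in>(Basis :: ('b::euclidean_space^'n) set). h b) = (\<Prod>j\<in>UNIV. \<Prod>c\<in>Basis. h (axis j c))"
proof -
  have B: "(Basis :: ('b^'n) set) = (\<lambda>p. axis (fst p) (snd p)) ` (UNIV \<times> Basis)"
    by (force simp: Basis_vec_def)
  have "(\<Prod>b\<in>(Basis :: ('b^'n) set). h b) = (\<Prod>p\<in>UNIV \<times> Basis. h (axis (fst p) (snd p)))"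
    by (rule prod.reindex_cong[where l = "\<lambda>p. axis (fst p) (snd p)"])
       (auto simp: inj_on_def axis_eq_axis B)
  then show ?thesis by (simp add: prod.cartesian_product case_prod_unfold)
qed

lemma distr_PiM_lborel_vec:
  "distr (Pi\<^sub>M UNIV (\<lambda>_::'n::finite. lborel :: 'b::euclidean_space measure)) borel (\<lambda>f. \<chi> j. f j) = lborel"
  (is "?D = _")
proof (rule lborel_eqI[symmetric])
  interpret product_sigma_finite "\<lambda>_::'n. lborel :: 'b measure" ..
  fix l u :: "'b^'n" assume le: "\<And>b. b \<in> Basis \<Longrightarrow> l \<bullet> b \<le> u \<bullet> b"
  have le': "l $ j \<bullet> c \<le> u $ j \<bullet> c" if "c \<in> Basis" for j c
    using le[of "axis j c"] that by (simp add: inner_axis)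
  have [measurable]: "(\<lambda>f. \<chi> j. f j) \<in> Pi\<^sub>M UNIV (\<lambda>_::'n. lborel :: 'b measure) \<rightarrow>\<^sub>M borel"
    by (rule measurable_vec_lambda) simp
  have "(\<lambda>f. \<chi> j. f j) -` box l u \<inter> space (Pi\<^sub>M UNIV (\<lambda>_::'n. lborel :: 'b measure)) =
        (\<Pi>\<^sub>E j\<in>UNIV. box (l $ j) (u $ j))"
    by (auto simp: mem_box Basis_vec_def inner_axis space_PiM PiE_def Pi_iff)
  then have "emeasure ?D (box l u) = (\<Prod>j\<in>UNIV. emeasure lborel (box (l $ j) (u $ j)))"
    by (subst emeasure_distr) (simp_all add: emeasure_PiM)
  also have "\<dots> = (\<Prod>j\<in>UNIV. \<Prod>c\<in>Basis. ennreal ((u $ j - l $ j) \<bullet> c))"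
    using le' by (simp add: emeasure_lborel_box prod_ennreal inner_diff_left)
  also have "\<dots> = (\<Prod>b\<in>Basis. ennreal ((u - l) \<bullet> b))"
    by (simp add: prod_Basis_vec inner_axis)
  finally show "emeasure ?D (box l u) = (\<Prod>b\<in>Basis. (u - l) \<bullet> b)"
    using le by (simp add: prod_ennreal inner_diff_left)
qed simp

lemma distr_PiM_cgauss:
  "distr (Pi\<^sub>M UNIV (\<lambda>_::'n::finite. cgauss)) borel (\<lambda>f. \<chi> j. f j) = (cgauss_vec :: (complex^'n) measure)"
proof -
  let ?g = "\<lambda>z. ennreal (exp (- (cmod z)\<^sup>2) / pi)"
  let ?L = "Pi\<^sub>M UNIV (\<lambda>_::'n. lborel :: complex measure)"
  interpret L: product_sigma_finite "\<lambda>_::'n. lborel :: complex measure" ..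
  interpret G: prob_space cgauss by (rule prob_space_cgauss)
  interpret P: product_sigma_finite "\<lambda>_::'n. cgauss" ..
  have dens: "density ?L (\<lambda>f. \<Prod>j\<in>UNIV. ?g (f j)) = Pi\<^sub>M UNIV (\<lambda>_::'n. cgauss)" (is "?D = _")
  proof (rule P.PiM_eqI)
    show "sets ?D = sets (Pi\<^sub>M UNIV (\<lambda>_::'n. cgauss))"
      by (simp cong: sets_PiM_cong)
    fix A :: "'n \<Rightarrow> complex set" assume "\<And>j. j \<in> UNIV \<Longrightarrow> A j \<in> sets cgauss"
    then have [measurable]: "A j \<in> sets borel" for j by simp
    have "emeasure ?D (Pi\<^sub>E UNIV A) = (\<integral>\<^sup>+f. (\<Prod>j\<in>UNIV. ?g (f j)) * indicator (Pi\<^sub>E UNIV A) f \<partial>?L)"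
      by (subst emeasure_density) auto
    also have "\<dots> = (\<integral>\<^sup>+f. (\<Prod>j\<in>UNIV. ?g (f j) * indicator (A j) (f j)) \<partial>?L)"
    proof -
      have "indicator (Pi\<^sub>E UNIV A) f = (\<Prod>j\<in>UNIV. indicator (A j) (f j) :: ennreal)" for f
        by (cases "\<forall>j. f j \<in> A j") (auto simp: PiE_def Pi_iff indicator_eq_0_iff)
      then show ?thesis by (simp add: prod.distrib)
    qed
    also have "\<dots> = (\<Prod>j\<in>UNIV. \<integral>\<^sup>+z. ?g z * indicator (A j) z \<partial>lborel)"
      by (rule L.product_nn_integral_prod) auto
    also have "\<dots> = (\<Prod>j\<in>UNIV. emeasure cgauss (A j))"
      by (simp add: cgauss_def emeasure_density)
    finally show "emeasure ?D (Pi\<^sub>E UNIV A) = (\<Prod>j\<in>UNIV. emeasure cgauss (A j))" .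
  qed simp
  have [measurable]: "(\<lambda>f. \<chi> j. f j) \<in> ?L \<rightarrow>\<^sub>M borel"
    by (rule measurable_vec_lambda) simp
  have "distr (Pi\<^sub>M UNIV (\<lambda>_::'n. cgauss)) borel (\<lambda>f. \<chi> j. f j) =
        distr (density ?L (\<lambda>f. (\<lambda>x::complex^'n. \<Prod>j\<in>UNIV. ?g (x $ j)) (\<chi> j. f j))) borel (\<lambda>f. \<chi> j. f j)"
    by (simp add: dens)
  also have "\<dots> = density (distr ?L borel (\<lambda>f. \<chi> j. f j)) (\<lambda>x::complex^'n. \<Prod>j\<in>UNIV. ?g (x $ j))"
    by (subst density_distr) auto
  also have "\<dots> = cgauss_vec"
  proof -
    have "(\<Prod>j\<in>UNIV. ?g (x $ j)) = ennreal (exp (- (norm x)\<^sup>2) / pi ^ CARD('n))" for x :: "complex^'n"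
      by (simp add: prod_ennreal prod_dividef exp_sum[symmetric] sum_negf norm_vec_def L2_set_def
          sum_nonneg)
    then show ?thesis unfolding distr_PiM_lborel_vec cgauss_vec_def by simp
  qed
  finally show ?thesis .
qed

lemma prob_space_cgauss_vec: "prob_space (cgauss_vec :: (complex^'n) measure)"
proof -
  have "(\<lambda>f. \<chi> j. f j) \<in> Pi\<^sub>M UNIV (\<lambda>_::'n. cgauss) \<rightarrow>\<^sub>M borel"
    by (rule measurable_vec_lambda) simp
  then show ?thesis
    unfolding distr_PiM_cgauss[symmetric] 
    by (intro prob_space.prob_space_distr prob_space_PiM prob_space_cgauss)
qed

text \<open>The density depends only on the norm, and Lebesgue measure is invariant under isometries.\<close>

lemma distr_cgauss_vec_orthogonal:
  fixes T :: "complex^'n \<Rightarrow> complex^'n"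
  assumes T: "orthogonal_transformation T"
  shows "distr cgauss_vec cgauss_vec T = cgauss_vec"
proof (rule measure_eqI)
  have T_meas[measurable]: "T \<in> borel_measurable borel"
    using orthogonal_transformation_linear[OF T]
    by (intro borel_measurable_continuous_onI) (simp add: linear_continuous_on linear_linear)
  fix A assume "A \<in> sets (distr cgauss_vec cgauss_vec T)"
  then have [measurable]: "A \<in> sets borel" by simp
  let ?g = "\<lambda>x. ennreal (exp (- (norm x)\<^sup>2) / pi ^ CARD('n))"
  have "emeasure (distr cgauss_vec cgauss_vec T) A = (\<integral>\<^sup>+x. indicator A (T x) \<partial>cgauss_vec)"
    by (subst nn_integral_indicator[symmetric], simp, subst nn_integral_distr) auto
  also have "\<dots> = (\<integral>\<^sup>+x. ?g (T x) * indicator A (T x) \<partial>lborel)"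
    unfolding cgauss_vec_def using T
    by (subst nn_integral_density) (auto simp: orthogonal_transformation_norm)
  also have "\<dots> = (\<integral>\<^sup>+x. ?g x * indicator A x \<partial>lborel)"
    by (rule nn_integral_lborel_orthogonal[OF T]) measurable
  also have "\<dots> = emeasure cgauss_vec A"
    by (simp add: cgauss_vec_def emeasure_density)
  finally show "emeasure (distr cgauss_vec cgauss_vec T) A = emeasure cgauss_vec A" .
qed simp

text \<open>Euler's integral for the Gamma function.\<close>

lemma erlang_moment:
  fixes s :: real
  assumes s: "s \<ge> 0" and n: "n \<ge> 1"
  shows "(\<integral>\<^sup>+r. ennreal (r powr s) \<partial>density lborel (erlang_density (n - 1) 1)) =
         ennreal (Gamma (n + s) / Gamma n)"
proof -
  have "(\<integral>\<^sup>+r. ennreal (r powr s) \<partial>density lborel (erlang_density (n - 1) 1)) =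
        (\<integral>\<^sup>+r. ennreal (erlang_density (n - 1) 1 r) * ennreal (r powr s) \<partial>lborel)"
    by (subst nn_integral_density) auto
  also have "\<dots> = (\<integral>\<^sup>+r. ennreal (inverse (Gamma n)) * ennreal (r powr (n + s - 1) / exp r * indicator {0..} r) \<partial>lborel)"
  proof (rule nn_integral_cong)
    fix r :: real
    show "ennreal (erlang_density (n - 1) 1 r) * ennreal (r powr s) =
      ennreal (inverse (Gamma n)) * ennreal (r powr (n + s - 1) / exp r * indicator {0..} r)"
    proof (cases "r > 0")
      case True
      have "r ^ (n - 1) = r powr (n - 1)" using True n by (simp add: powr_realpow[symmetric] of_nat_diff)
      moreover have "r powr (n - 1) * r powr s = r powr (n + s - 1)"
        using n by (simp add: powr_add[symmetric] of_nat_diff algebra_simps)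
      moreover have "Gamma (real n) = fact (n - 1)"
        using n Gamma_fact[of "n - 1", where 'a = real] by (simp add: of_nat_diff)
      ultimately show ?thesis
        using True by (simp add: erlang_density_def ennreal_mult'[symmetric] exp_minus field_simps)
    next
      case False
      then show ?thesis by (auto simp: erlang_density_def indicator_def)
    qed
  qed
  also have "\<dots> = ennreal (inverse (Gamma n)) * (\<integral>\<^sup>+r. ennreal (r powr (n + s - 1) / exp r * indicator {0..} r) \<partial>lborel)"
    by (rule nn_integral_cmult) measurable
  also have "(\<integral>\<^sup>+r. ennreal (r powr (n + s - 1) / exp r * indicator {0..} r) \<partial>lborel) = ennreal (Gamma (n + s))"
    using nn_integral_has_integral_lebesgue[OF _ Gamma_integral_real[of "n + s"]] n s
    by (simp add: mult.commute)
  finally show ?thesis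
    using n s by (simp add: ennreal_mult'[symmetric] field_simps Gamma_real_nonneg)
qed

text \<open>The squared moduli of the coordinates are independent exponential variables, so their sum has an
  Erlang distribution.\<close>

lemma cgauss_vec_partial_norm_moment:
  fixes T :: "'n::finite set" and s :: real
  assumes s: "s \<ge> 0" and T: "T \<noteq> {}"
  shows "(\<integral>\<^sup>+x. ennreal ((\<Sum>j\<in>T. (cmod (x $ j))\<^sup>2) powr s) \<partial>(cgauss_vec :: (complex^'n) measure)) =
         ennreal (Gamma (card T + s) / Gamma (card T))"
proof -
  let ?P = "Pi\<^sub>M UNIV (\<lambda>_::'n. cgauss)"
  interpret P: product_prob_space "\<lambda>_::'n. cgauss" UNIV
    by (intro product_prob_spaceI prob_space_cgauss)
  have comp: "distr ?P borel (\<lambda>f. f j) = cgauss" for j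
    using P.PiM_component[of j] by (simp cong: distr_cong)
  have "P.indep_vars (\<lambda>_. borel) (\<lambda>j f. f j) UNIV"
    by (subst P.indep_vars_iff_distr_eq_PiM')
       (auto simp: comp restrict_UNIV distr_id2 cong: sets_PiM_cong)
  then have "P.indep_vars (\<lambda>_. borel) (\<lambda>j f. f j) T"
    by (rule P.indep_vars_subset) simp
  then have ind: "P.indep_vars (\<lambda>_. borel) (\<lambda>j f. (cmod (f j))\<^sup>2) T"
    by (rule P.indep_vars_compose2) simp
  have "distributed ?P lborel (\<lambda>f. (cmod (f j))\<^sup>2) (exponential_density 1)" for j
  proof -
    have "distr ?P lborel (\<lambda>f. (cmod (f j))\<^sup>2) = distr (distr ?P borel (\<lambda>f. f j)) borel (\<lambda>z. (cmod z)\<^sup>2)"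
      by (subst distr_distr) (auto simp: comp_def cong: distr_cong)
    also have "\<dots> = density lborel (exponential_density 1)"
      by (simp add: comp distr_cgauss_cmod_sq)
    finally show ?thesis by (simp add: distributed_def)
  qed
  then have "distributed ?P lborel (\<lambda>f. \<Sum>j\<in>T. (cmod (f j))\<^sup>2) (erlang_density (card T - 1) 1)"
    using T ind by (intro P.exponential_distributed_sum) auto
  then have D: "distr ?P lborel (\<lambda>f. \<Sum>j\<in>T. (cmod (f j))\<^sup>2) = density lborel (erlang_density (card T - 1) 1)"
    by (simp add: distributed_def)
  have [measurable]: "(\<lambda>f. \<chi> j. f j) \<in> ?P \<rightarrow>\<^sub>M borel"
    by (rule measurable_vec_lambda) simp
  have "(\<integral>\<^sup>+x. ennreal ((\<Sum>j\<in>T. (cmod (x $ j))\<^sup>2) powr s) \<partial>(cgauss_vec :: (complex^'n) measure)) =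
        (\<integral>\<^sup>+f. ennreal ((\<Sum>j\<in>T. (cmod (f j))\<^sup>2) powr s) \<partial>?P)"
    unfolding distr_PiM_cgauss[symmetric] by (subst nn_integral_distr) auto
  also have "\<dots> = (\<integral>\<^sup>+r. ennreal (r powr s) \<partial>distr ?P lborel (\<lambda>f. \<Sum>j\<in>T. (cmod (f j))\<^sup>2))"
    by (subst nn_integral_distr) auto
  also have "\<dots> = ennreal (Gamma (card T + s) / Gamma (card T))"
    unfolding D using T by (intro erlang_moment s) (simp add: Suc_le_eq card_gt_0_iff)
  finally show ?thesis .
qed

section \<open>Unitary reflections\<close>

definition herm :: "complex^'n \<Rightarrow> complex^'n \<Rightarrow> complex" where
  "herm x y = (\<Sum>j\<in>UNIV. x $ j * cnj (y $ j))"

text \<open>The Householder reflection in the complex hyperplane orthogonal to \<open>w\<close>. For \<open>w = 0\<close> the division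
  by \<open>0\<close> makes it the identity, which is the correct value in \<open>reflection_to_axis\<close> for a vector that
  already lies on the axis.\<close>

definition reflection :: "complex^'n \<Rightarrow> complex^'n \<Rightarrow> complex^'n" where
  "reflection w x = x - (2 * herm x w / herm w w) *s w"

text \<open>Rows of matrices are the vectors of interest, so this matrix acts by multiplication from the
  right.\<close>

definition reflection_matrix :: "complex^'n \<Rightarrow> complex^'n^'n" where
  "reflection_matrix w = (\<chi> k j. (if k = j then 1 else 0) - 2 * cnj (w $ k) * w $ j / herm w w)"

lemma herm_self: "herm x x = of_real ((norm x)\<^sup>2)"
  by (simp add: herm_def norm_vec_def L2_set_def sum_nonneg complex_norm_square del: of_real_power)

lemma herm_cnj: "cnj (herm x y) = herm y x"
  by (simp add: herm_def mult.commute)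

lemma herm_add: "herm (x + y) w = herm x w + herm y w"
  by (simp add: herm_def algebra_simps sum.distrib)

lemma herm_scaleR: "herm (c *\<^sub>R x) w = c *\<^sub>R herm x w"
  by (simp add: herm_def scaleR_sum_right)

lemma orthogonal_transformation_reflection: "orthogonal_transformation (reflection w)"
  unfolding orthogonal_transformation
proof (intro conjI allI)
  show "linear (reflection w)"
    by (rule linearI)
       (simp_all add: reflection_def herm_add herm_scaleR vec_eq_iff,
        simp_all add: scaleR_conv_of_real add_divide_distrib algebra_simps)
  fix x
  show "norm (reflection w x) = norm x"
  proof (cases "w = 0")
    case True
    then show ?thesis by (simp add: reflection_def)
  next
    case False
    define c where "c = 2 * herm x w / herm w w"
    have lin: "herm (x - c *s w) (x - c *s w) =
        herm x x - c * herm w x - cnj c * herm x w + c * cnj c * herm w w"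
      by (simp add: herm_def algebra_simps sum.distrib sum_subtractf sum_distrib_left)
    have "herm w w \<noteq> 0" using False by (simp add: herm_self)
    moreover have "cnj (herm w w) = herm w w" by (rule herm_cnj)
    ultimately have "herm (reflection w x) (reflection w x) = herm x x"
      unfolding reflection_def c_def[symmetric] lin
      by (simp add: c_def herm_cnj field_simps)
    then have "(norm (reflection w x))\<^sup>2 = (norm x)\<^sup>2"
      unfolding herm_self of_real_eq_iff .
    then show ?thesis by (simp add: power2_eq_iff_nonneg)
  qed
qed

text \<open>A reflection is an involution.\<close>

lemma cmod_det_reflection_matrix: "cmod (det (reflection_matrix w)) = 1"
proof -
  have "reflection_matrix w ** reflection_matrix w = mat 1"
  proof (cases "w = 0")
    case True
    then have "reflection_matrix w = mat 1"
      by (simp add: reflection_matrix_def vec_eq_iff mat_def)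
    then show ?thesis by simp
  next
    case False
    then have nz: "herm w w \<noteq> 0" by (simp add: herm_self)
    have "(\<Sum>k\<in>UNIV. ((if i = k then 1 else 0) - 2 * cnj (w $ i) * w $ k / herm w w) *
            ((if k = j then 1 else 0) - 2 * cnj (w $ k) * w $ j / herm w w)) =
          (if i = j then 1 else 0)" for i j
    proof -
      let ?d = "\<lambda>i k. if i = k then 1 else (0::complex)"
      have delta: "(\<Sum>k\<in>UNIV. ?d i k * f k) = f i" "(\<Sum>k\<in>UNIV. ?d k j * f k) = f j" for f
        by (simp_all add: if_distrib[where f = "\<lambda>x. x * _"] cong: if_cong)
      have "(\<Sum>k\<in>UNIV. (?d i k - 2 * cnj (w $ i) * w $ k / herm w w) *
              (?d k j - 2 * cnj (w $ k) * w $ j / herm w w)) =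
            (\<Sum>k\<in>UNIV. ?d i k * ?d k j) - (\<Sum>k\<in>UNIV. ?d i k * (2 * cnj (w $ k) * w $ j / herm w w))
            - (\<Sum>k\<in>UNIV. ?d k j * (2 * cnj (w $ i) * w $ k / herm w w))
            + 4 * cnj (w $ i) * w $ j / (herm w w)\<^sup>2 * (\<Sum>k\<in>UNIV. w $ k * cnj (w $ k))"
        by (simp add: sum_subtractf[symmetric] sum.distrib[symmetric] sum_distrib_left
            sum_divide_distrib algebra_simps power2_eq_square)
      also have "(\<Sum>k\<in>UNIV. ?d i k * ?d k j) = ?d i j"
        by (rule delta)
      also have "(\<Sum>k\<in>UNIV. ?d i k * (2 * cnj (w $ k) * w $ j / herm w w)) = 2 * cnj (w $ i) * w $ j / herm w w"
        by (rule delta)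
      also have "(\<Sum>k\<in>UNIV. ?d k j * (2 * cnj (w $ i) * w $ k / herm w w)) = 2 * cnj (w $ i) * w $ j / herm w w"
        by (rule delta)
      also have "(\<Sum>k\<in>UNIV. w $ k * cnj (w $ k)) = herm w w"
        by (simp add: herm_def)
      finally show ?thesis using nz by (simp add: power2_eq_square)
    qed
    then show ?thesis
      by (simp add: vec_eq_iff reflection_matrix_def matrix_matrix_mult_def mat_def)
  qed
  then have "det (reflection_matrix w) * det (reflection_matrix w) = 1"
    by (metis det_I det_mul)
  then have "cmod (det (reflection_matrix w)) ^ 2 = 1"
    by (metis norm_mult norm_one power2_eq_square)
  then show ?thesis by (simp add: power2_eq_1_iff) (smt (verit) norm_ge_zero)
qed

text \<open>The reflection along \<open>x - y\<close> sends \<open>x\<close> to \<open>y\<close> when both have the same norm and \<open>herm x y\<close> is real.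
  Over the complex numbers the second condition forces the phase of \<open>y\<close>: the entry \<open>\<alpha>\<close> gets the
  phase of \<open>x $ a\<close>. If \<open>x\<close> is supported on \<open>T\<close>, so is \<open>w\<close>; this keeps the reflection inside the
  coordinates that a bordered minor sees.\<close>

lemma reflection_to_axis:
  assumes x: "\<And>j. j \<notin> T \<Longrightarrow> x $ j = 0" and a: "a \<in> T"
  obtains w \<alpha> where "\<And>j. j \<notin> T \<Longrightarrow> w $ j = 0" "reflection w x = axis a \<alpha>" "cmod \<alpha> = norm x"
proof -
  \<comment> \<open>the phase of \<open>x $ a\<close>; any phase will do if that entry vanishes\<close>
  define u where "u = (if x $ a = 0 then 1 else sgn (x $ a))"
  define \<alpha> where "\<alpha> = of_real (norm x) * u"
  define w where "w = x - axis a \<alpha>"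
  have u: "cmod u = 1" by (simp add: u_def norm_sgn)
  have \<alpha>: "cmod \<alpha> = norm x" by (simp add: \<alpha>_def norm_mult u)
  have "x $ a * cnj u = of_real (cmod (x $ a))"
    by (auto simp: u_def sgn_eq complex_norm_square[symmetric] power2_eq_square
        simp flip: of_real_mult) simp
  then have real: "x $ a * cnj \<alpha> = of_real (norm x * cmod (x $ a))"
    by (simp add: \<alpha>_def algebra_simps)
  have xa: "herm x (axis a \<alpha>) = x $ a * cnj \<alpha>"
    by (simp add: herm_def axis_def if_distrib[where f = cnj] if_distrib[where f = "\<lambda>z. _ * z"]
        cong: if_cong)
  have aa: "herm (axis a \<alpha>) (axis a \<alpha>) = herm x x"
  proof -
    have "norm (axis a \<alpha>) = cmod \<alpha>"
      by (simp add: norm_eq_sqrt_inner inner_axis_axis)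
    then show ?thesis by (simp add: herm_self \<alpha>)
  qed
  have ax: "herm (axis a \<alpha>) x = herm x (axis a \<alpha>)"
    using herm_cnj[of x "axis a \<alpha>"] by (simp add: xa real)
  have ww: "herm w w = 2 * herm x w"
  proof -
    have "herm w w = herm x x - herm x (axis a \<alpha>) - herm (axis a \<alpha>) x + herm (axis a \<alpha>) (axis a \<alpha>)"
      by (simp add: w_def herm_def algebra_simps sum.distrib sum_subtractf)
    moreover have "herm x w = herm x x - herm x (axis a \<alpha>)"
      by (simp add: w_def herm_def algebra_simps sum_subtractf)
    ultimately show ?thesis by (simp add: aa ax)
  qed
  have "reflection w x = axis a \<alpha>"
  proof (cases "w = 0")
    case True
    then show ?thesis by (simp add: reflection_def) (simp add: w_def)
  next
    case False
    then have "2 * herm x w / herm w w = 1"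
      unfolding ww[symmetric] by (simp add: herm_self)
    then show ?thesis by (simp add: reflection_def) (simp add: w_def)
  qed
  moreover have "w $ j = 0" if "j \<notin> T" for j
    using that x a by (auto simp: w_def axis_def)
  ultimately show thesis using that \<alpha> by blast
qed

section \<open>Moments of Gaussian determinants\<close>

text \<open>The principal submatrix on \<open>S\<close>, bordered by an identity matrix. All sizes thus live in the same matrix
  type, and an induction on the size becomes an induction on the finite set \<open>S\<close>.\<close>

definition bordered :: "'n set \<Rightarrow> ('n \<Rightarrow> complex^'n) \<Rightarrow> complex^'n^'n" where
  "bordered S r = (\<chi> i j. if i \<in> S \<and> j \<in> S then r i $ j else if i = j then 1 else 0)"

lemma bordered_reflection:
  assumes w: "\<And>j. j \<notin> T \<Longrightarrow> w $ j = 0"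
  shows "bordered T (\<lambda>i. reflection w (r i)) = bordered T r ** reflection_matrix w"
proof -
  have "bordered T (\<lambda>i. reflection w (r i)) $ i $ j = (bordered T r ** reflection_matrix w) $ i $ j" for i j
  proof -
    let ?M = "bordered T r"
    have "(?M ** reflection_matrix w) $ i $ j =
          ?M $ i $ j - 2 * (\<Sum>k\<in>UNIV. ?M $ i $ k * cnj (w $ k)) / herm w w * w $ j"
      by (simp add: matrix_matrix_mult_def reflection_matrix_def algebra_simps sum_subtractf
          sum_distrib_left sum_distrib_right sum_divide_distrib
          if_distrib[where f = "\<lambda>z. z * _"] cong: if_cong)
    also have "\<dots> = bordered T (\<lambda>i. reflection w (r i)) $ i $ j"
    proof (cases "i \<in> T \<and> j \<in> T")
      case True
      have "(\<Sum>k\<in>UNIV. ?M $ i $ k * cnj (w $ k)) = herm (r i) w"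
        unfolding herm_def using True w by (intro sum.cong) (auto simp: bordered_def)
      then show ?thesis using True by (simp add: bordered_def reflection_def)
    next
      case False
      have "(\<Sum>k\<in>UNIV. ?M $ i $ k * cnj (w $ k)) = 0" if "i \<notin> T"
        using that w by (intro sum.neutral) (auto simp: bordered_def)
      with False w show ?thesis by (auto simp: bordered_def)
    qed
    finally show ?thesis by simp
  qed
  then show ?thesis by (simp add: vec_eq_iff)
qed

lemma det_bordered_axis_row:
  assumes a: "a \<notin> S" and row: "\<And>j. j \<in> S \<Longrightarrow> r a $ j = 0"
  shows "det (bordered (insert a S) r) = r a $ a * det (bordered S r)"
proof -
  let ?M = "bordered (insert a S) r" and ?M' = "bordered S r"
  have "(\<Prod>i\<in>UNIV. ?M $ i $ p i) = r a $ a * (\<Prod>i\<in>UNIV. ?M' $ i $ p i)" if p: "p permutes UNIV" for p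
  proof (cases "p a = a")
    case True
    have ne: "p i \<noteq> a" if "i \<noteq> a" for i
      using permutes_inj[OF p] True that by (metis injD)
    have "(\<Prod>i\<in>UNIV - {a}. ?M $ i $ p i) = (\<Prod>i\<in>UNIV - {a}. ?M' $ i $ p i)"
      using ne by (intro prod.cong) (auto simp: bordered_def)
    then show ?thesis
      using True a by (simp add: prod.remove[of UNIV a]) (simp add: bordered_def)
  next
    case False
    then have "?M $ a $ p a = 0" "?M' $ a $ p a = 0"
      using row a by (auto simp: bordered_def)
    then have "(\<Prod>i\<in>UNIV. ?M $ i $ p i) = 0" "(\<Prod>i\<in>UNIV. ?M' $ i $ p i) = 0"
      by (auto intro!: prod_zero)
    then show ?thesis by (simp only: mult_zero_right)
  qed
  then show ?thesis
    by (simp add: det_def sum_distrib_left mult.left_commute)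
qed

text \<open>After the reflection that takes the part of \<open>x\<close> supported on \<open>insert a S\<close> to the axis \<open>a\<close>, the
  determinant can be expanded along row \<open>a\<close>. The vector \<open>w\<close> depends on \<open>x\<close> but not on the other
  rows \<open>r\<close>, so that for fixed \<open>x\<close> the rotation invariance of the law of \<open>r\<close> applies.\<close>

lemma det_bordered_insert:
  fixes S :: "'n::finite set"
  assumes a: "a \<notin> S"
  obtains w where "\<And>r. cmod (det (bordered (insert a S) (r(a := x)))) =
    sqrt (\<Sum>j\<in>insert a S. (cmod (x $ j))\<^sup>2) * cmod (det (bordered S (\<lambda>i. reflection w (r i))))"
proof -
  let ?T = "insert a S"
  define x' where "x' = (\<chi> j. if j \<in> ?T then x $ j else 0)"
  obtain w \<alpha> where w: "\<And>j. j \<notin> ?T \<Longrightarrow> w $ j = 0" "reflection w x' = axis a \<alpha>" "cmod \<alpha> = norm x'"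
    by (rule reflection_to_axis[of ?T x' a]) (auto simp: x'_def)
  have norm: "norm x' = sqrt (\<Sum>j\<in>?T. (cmod (x $ j))\<^sup>2)"
    unfolding norm_vec_def L2_set_def x'_def
    by (rule arg_cong[where f = sqrt], rule sum.mono_neutral_cong_right) auto
  \<comment> \<open>since \<open>w\<close> vanishes outside \<open>?T\<close>, reflecting \<open>x\<close> or its truncation \<open>x\'\<close> gives the same entries in \<open>?T\<close>\<close>
  have refl: "reflection w x $ j = axis a \<alpha> $ j" if "j \<in> ?T" for j
  proof -
    have "herm x w = herm x' w"
      unfolding herm_def x'_def using w(1) by (intro sum.cong) auto
    then have "reflection w x $ j = reflection w x' $ j"
      using that by (simp add: reflection_def x'_def)
    then show ?thesis using w(2) by simp
  qed
  have "cmod (det (bordered ?T (r(a := x)))) = norm x' * cmod (det (bordered S (\<lambda>i. reflection w (r i))))" for r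
  proof -
    let ?r = "\<lambda>i. reflection w ((r(a := x)) i)"
    have "cmod (det (bordered ?T (r(a := x)))) = cmod (det (bordered ?T ?r))"
    proof -
      have "bordered ?T ?r = bordered ?T (r(a := x)) ** reflection_matrix w"
        by (rule bordered_reflection[OF w(1)])
      then show ?thesis
        by (simp only: det_mul norm_mult cmod_det_reflection_matrix mult_1_right)
    qed
    also have "det (bordered ?T ?r) = ?r a $ a * det (bordered S ?r)"
    proof (rule det_bordered_axis_row[OF a])
      fix j assume "j \<in> S"
      then show "?r a $ j = 0" using refl[of j] a by (auto simp: axis_def)
    qed
    also have "?r a $ a = \<alpha>" using refl[of a] by simp
    also have "bordered S ?r = bordered S (\<lambda>i. reflection w (r i))"
      using a by (auto simp: bordered_def vec_eq_iff)
    finally show ?thesis unfolding norm_mult w(3) .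
  qed
  from this[unfolded norm] show thesis by (rule that)
qed

lemma measurable_det:
  fixes A :: "'a \<Rightarrow> complex^'n^'n"
  assumes [measurable]: "\<And>i j. (\<lambda>x. A x $ i $ j) \<in> borel_measurable M"
  shows "(\<lambda>x. det (A x)) \<in> borel_measurable M"
  unfolding det_def by measurable

lemma measurable_det_bordered [measurable]:
  fixes S :: "'n::finite set"
  shows "(\<lambda>r. det (bordered S r)) \<in> borel_measurable (Pi\<^sub>M S (\<lambda>_. cgauss_vec))"
proof (rule measurable_det)
  fix i j
  show "(\<lambda>r. bordered S r $ i $ j) \<in> borel_measurable (Pi\<^sub>M S (\<lambda>_. cgauss_vec))"
  proof (cases "i \<in> S")
    case True
    have "(\<lambda>x. x $ j) \<in> borel_measurable (cgauss_vec :: (complex^'n) measure)"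
      by measurable
    then have "(\<lambda>r. r i $ j) \<in> borel_measurable (Pi\<^sub>M S (\<lambda>_. cgauss_vec :: (complex^'n) measure))"
      by (rule measurable_compose[OF measurable_component_singleton[OF True]])
    then show ?thesis by (simp add: bordered_def)
  qed (simp add: bordered_def)
qed

text \<open>Integrate over the rows in \<open>S\<close> first, with row \<open>a\<close> fixed at \<open>x\<close>: by rotation invariance the result
  is the moment for \<open>S\<close> times a power of the norm of the relevant part of \<open>x\<close>. The integral over
  \<open>x\<close> then supplies the new Gamma quotient.\<close>

lemma det_bordered_moment:
  fixes S :: "'n::finite set" and s :: real
  assumes s: "s \<ge> 0"
  shows "(\<integral>\<^sup>+r. ennreal (cmod (det (bordered S r)) powr (2 * s)) \<partial>Pi\<^sub>M S (\<lambda>_. cgauss_vec)) =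
         (\<Prod>m=1..card S. ennreal (Gamma (m + s) / Gamma m))"
  using finite[of S]
proof (induction S)
  case empty
  have "bordered {} (\<lambda>_. undefined) = (mat 1 :: complex^'n^'n)"
    by (simp add: bordered_def mat_def)
  then show ?case
    by (simp add: PiM_empty nn_integral_count_space_finite)
next
  case (insert a S)
  interpret G: prob_space "cgauss_vec :: (complex^'n) measure" by (rule prob_space_cgauss_vec)
  interpret P: product_sigma_finite "\<lambda>_::'n. cgauss_vec :: (complex^'n) measure" ..
  let ?P = "Pi\<^sub>M S (\<lambda>_. cgauss_vec :: (complex^'n) measure)"
  define I where "I = (\<integral>\<^sup>+r. ennreal (cmod (det (bordered S r)) powr (2 * s)) \<partial>?P)"
  have inner: "(\<integral>\<^sup>+r. ennreal (cmod (det (bordered (insert a S) (r(a := x)))) powr (2 * s)) \<partial>?P) =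
        ennreal ((\<Sum>j\<in>insert a S. (cmod (x $ j))\<^sup>2) powr s) * I" for x
  proof -
    let ?q = "\<Sum>j\<in>insert a S. (cmod (x $ j))\<^sup>2"
    obtain w where w: "\<And>r. cmod (det (bordered (insert a S) (r(a := x)))) =
        sqrt ?q * cmod (det (bordered S (\<lambda>i. reflection w (r i))))"
      using det_bordered_insert[OF insert.hyps(2)] by metis
    have [measurable]: "reflection w \<in> cgauss_vec \<rightarrow>\<^sub>M cgauss_vec"
      using orthogonal_transformation_linear[OF orthogonal_transformation_reflection[of w]]
      by (simp add: borel_measurable_continuous_onI linear_continuous_on linear_linear
          cong: measurable_cong_sets)
    have [measurable]: "compose S (reflection w) \<in> ?P \<rightarrow>\<^sub>M ?P"
      unfolding compose_def by measurable
    have q: "0 \<le> ?q" by (simp add: sum_nonneg)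
    have "sqrt ?q powr (2 * s) = ?q powr s"
      using q by (simp add: powr_half_sqrt[symmetric] powr_powr)
    then have "(\<integral>\<^sup>+r. ennreal (cmod (det (bordered (insert a S) (r(a := x)))) powr (2 * s)) \<partial>?P) =
      (\<integral>\<^sup>+r. ennreal (?q powr s) * ennreal (cmod (det (bordered S (compose S (reflection w) r))) powr (2 * s)) \<partial>?P)"
    proof -
      have "bordered S (compose S (reflection w) r) = bordered S (\<lambda>i. reflection w (r i))" for r
        by (simp add: bordered_def compose_def vec_eq_iff)
      then show ?thesis
        using \<open>sqrt ?q powr (2 * s) = ?q powr s\<close> by (simp add: w powr_mult q ennreal_mult del: sum.insert)
    qed
    also have "\<dots> = ennreal (?q powr s) * (\<integral>\<^sup>+r. ennreal (cmod (det (bordered S (compose S (reflection w) r))) powr (2 * s)) \<partial>?P)"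
      by (rule nn_integral_cmult) (simp add: compose_def)
    also have "(\<integral>\<^sup>+r. ennreal (cmod (det (bordered S (compose S (reflection w) r))) powr (2 * s)) \<partial>?P) =
        (\<integral>\<^sup>+r. ennreal (cmod (det (bordered S r)) powr (2 * s)) \<partial>distr ?P ?P (compose S (reflection w)))"
      by (subst nn_integral_distr) (auto simp: compose_def)
    also have "distr ?P ?P (compose S (reflection w)) = ?P"
      by (subst distr_PiM_finite_prob_space')
         (auto simp: distr_cgauss_vec_orthogonal orthogonal_transformation_reflection
            prob_space_cgauss_vec)
    finally show ?thesis unfolding I_def .
  qed
  have "(\<integral>\<^sup>+r. ennreal (cmod (det (bordered (insert a S) r)) powr (2 * s)) \<partial>Pi\<^sub>M (insert a S) (\<lambda>_. cgauss_vec)) =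
    (\<integral>\<^sup>+x. \<integral>\<^sup>+r. ennreal (cmod (det (bordered (insert a S) (r(a := x)))) powr (2 * s)) \<partial>?P \<partial>cgauss_vec)"
    by (rule P.product_nn_integral_insert_rev[OF insert.hyps]) measurable
  also have "\<dots> = (\<integral>\<^sup>+x. ennreal ((\<Sum>j\<in>insert a S. (cmod (x $ j))\<^sup>2) powr s) \<partial>cgauss_vec) * I"
    unfolding inner by (rule nn_integral_multc) measurable
  also have "\<dots> = ennreal (Gamma (card (insert a S) + s) / Gamma (card (insert a S))) * I"
    by (subst cgauss_vec_partial_norm_moment[OF s]) auto
  also have "\<dots> = (\<Prod>m=1..card (insert a S). ennreal (Gamma (m + s) / Gamma m))"
    using insert by (simp add: I_def mult.commute)
  finally show ?case .
qed

section \<open>The law of a Gaussian matrix\<close>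

lemma (in prob_space) indep_vars_reindex:
  assumes ind: "indep_vars M' X I" and f: "inj_on f J" "f ` J \<subseteq> I"
  shows "indep_vars (\<lambda>j. M' (f j)) (\<lambda>j. X (f j)) J"
proof -
  have "indep_vars (\<lambda>j. Pi\<^sub>M {f j} M') (\<lambda>j \<omega>. restrict (\<lambda>i. X i \<omega>) {f j}) J"
    by (rule indep_vars_restrict[OF ind]) (use f in \<open>auto simp: disjoint_family_on_def inj_on_def\<close>)
  then have "indep_vars (\<lambda>j. M' (f j)) (\<lambda>j \<omega>. restrict (\<lambda>i. X i \<omega>) {f j} (f j)) J"
    by (rule indep_vars_compose2[where Y = "\<lambda>j g. g (f j)"]) simp
  then show ?thesis by simp
qed

lemma standard_complex_normal_distr:
  assumes "standard_complex_normal M X"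
  shows "distr M borel X = cgauss" "X \<in> borel_measurable M"
proof -
  have "distr M borel X = distr M lborel X"
    by (rule distr_cong) auto
  then show "distr M borel X = cgauss" "X \<in> borel_measurable M"
    using assms by (auto simp: standard_complex_normal_def distributed_def cgauss_def)
qed

text \<open>The entries are grouped into rows. Each row has law \<open>cgauss_vec\<close> and the rows are independent, so
  the moment formula for \<open>bordered UNIV\<close> applies.\<close>

lemma (in prob_space) complex_gaussian_det_moment:
  fixes G :: "'a \<Rightarrow> complex^'n^'n" and s :: real
  assumes normal: "\<And>j k. standard_complex_normal M (\<lambda>\<omega>. G \<omega> $ j $ k)"
    and indep: "indep_vars (\<lambda>_. borel) (\<lambda>(j, k) \<omega>. G \<omega> $ j $ k) UNIV"
    and s: "s \<ge> 0"
  shows "(\<integral>\<^sup>+\<omega>. ennreal (cmod (det (G \<omega>)) powr (2 * s)) \<partial>M) =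
         (\<Prod>m=1..CARD('n). ennreal (Gamma (m + s) / Gamma m))"
proof -
  note [measurable] = standard_complex_normal_distr(2)[OF normal]
  have row: "distr M borel (\<lambda>\<omega>. G \<omega> $ j) = cgauss_vec" for j
  proof -
    have "indep_vars (\<lambda>_. borel) (\<lambda>k \<omega>. G \<omega> $ j $ k) UNIV"
      using indep_vars_reindex[OF indep, of "\<lambda>k. (j, k)" UNIV] by (simp add: inj_on_def)
    then have "distr M (Pi\<^sub>M UNIV (\<lambda>_. borel)) (\<lambda>\<omega> k. G \<omega> $ j $ k) = Pi\<^sub>M UNIV (\<lambda>_. cgauss)"
      by (subst (asm) indep_vars_iff_distr_eq_PiM)
         (simp_all add: standard_complex_normal_distr(1)[OF normal] restrict_UNIV)
    then have "cgauss_vec = distr (distr M (Pi\<^sub>M UNIV (\<lambda>_. borel)) (\<lambda>\<omega> k. G \<omega> $ j $ k)) borel (\<lambda>f. \<chi> k. f k)"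
      by (simp add: distr_PiM_cgauss)
    also have "\<dots> = distr M borel (\<lambda>\<omega>. \<chi> k. G \<omega> $ j $ k)"
      by (subst distr_distr) (auto simp: comp_def intro!: measurable_vec_lambda measurable_PiM_single')
    finally show ?thesis by simp
  qed
  have row_meas[measurable]: "(\<lambda>\<omega>. G \<omega> $ j) \<in> borel_measurable M" for j
    using measurable_vec_lambda[of "\<lambda>\<omega> k. G \<omega> $ j $ k" M] by simp
  have "indep_vars (\<lambda>j. Pi\<^sub>M ({j} \<times> UNIV) (\<lambda>_. borel))
      (\<lambda>j \<omega>. restrict (\<lambda>i. (\<lambda>(j, k) \<omega>. G \<omega> $ j $ k) i \<omega>) ({j} \<times> UNIV)) UNIV"
    by (rule indep_vars_restrict[OF indep]) (auto simp: disjoint_family_on_def)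
  then have "indep_vars (\<lambda>_. borel)
      (\<lambda>j \<omega>. \<chi> k. restrict (\<lambda>i. (\<lambda>(j, k) \<omega>. G \<omega> $ j $ k) i \<omega>) ({j} \<times> UNIV) (j, k)) UNIV"
    by (rule indep_vars_compose2[where Y = "\<lambda>j g. \<chi> k. g (j, k)"])
       (auto intro!: measurable_vec_lambda measurable_component_singleton)
  then have "indep_vars (\<lambda>_. borel) (\<lambda>j \<omega>. G \<omega> $ j) UNIV"
    by simp
  then have rows: "distr M (Pi\<^sub>M UNIV (\<lambda>_. borel)) (\<lambda>\<omega> j. G \<omega> $ j) = Pi\<^sub>M UNIV (\<lambda>_. cgauss_vec)"
    by (subst (asm) indep_vars_iff_distr_eq_PiM) (simp_all add: row restrict_UNIV)
  have sets: "sets (Pi\<^sub>M UNIV (\<lambda>_::'n. borel :: (complex^'n) measure)) = sets (Pi\<^sub>M UNIV (\<lambda>_. cgauss_vec))"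
    by (rule sets_PiM_cong) auto
  have "(\<integral>\<^sup>+\<omega>. ennreal (cmod (det (G \<omega>)) powr (2 * s)) \<partial>M) =
        (\<integral>\<^sup>+\<omega>. ennreal (cmod (det (bordered UNIV (\<lambda>j. G \<omega> $ j))) powr (2 * s)) \<partial>M)"
    by (simp add: bordered_def)
  also have "\<dots> = (\<integral>\<^sup>+r. ennreal (cmod (det (bordered UNIV r)) powr (2 * s))
      \<partial>distr M (Pi\<^sub>M UNIV (\<lambda>_. borel)) (\<lambda>\<omega> j. G \<omega> $ j))"
    by (subst nn_integral_distr)
       (auto simp: measurable_cong_sets[OF sets refl] intro!: measurable_PiM_single')
  also have "\<dots> = (\<Prod>m=1..CARD('n). ennreal (Gamma (m + s) / Gamma m))"
    unfolding rows by (rule det_bordered_moment[OF s])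
  finally show ?thesis .
qed

section \<open>Geometric means of Gaussian determinants\<close>

text \<open>The second moment of \<open>X N - b\<close> tends to \<open>b\<^sup>2 - 2 * b * b + b\<^sup>2 = 0\<close>, and by Fatou's lemma it
  dominates \<open>(L - b)\<^sup>2\<close> in the limit.\<close>

lemma (in prob_space) AE_limit_eq_of_moments:
  fixes X :: "nat \<Rightarrow> 'a \<Rightarrow> real" and L b :: real
  assumes [measurable]: "\<And>N. X N \<in> borel_measurable M" and nonneg: "\<And>N \<omega>. 0 \<le> X N \<omega>"
    and first: "\<And>N. (\<integral>\<^sup>+\<omega>. ennreal (X N \<omega>) \<partial>M) = ennreal (a N)" "\<And>N. 0 \<le> a N" "a \<longlonglongrightarrow> b"
    and second: "\<And>N. (\<integral>\<^sup>+\<omega>. ennreal ((X N \<omega>)\<^sup>2) \<partial>M) = ennreal (c N)" "\<And>N. 0 \<le> c N" "c \<longlonglongrightarrow> b\<^sup>2"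
    and lim: "AE \<omega> in M. (\<lambda>N. X N \<omega>) \<longlonglongrightarrow> L"
  shows "L = b"
proof -
  have var: "(\<integral>\<^sup>+\<omega>. ennreal ((X N \<omega> - b)\<^sup>2) \<partial>M) = ennreal (c N - 2 * b * a N + b\<^sup>2)" for N
  proof -
    have int: "integrable M (X N)" "integrable M (\<lambda>\<omega>. (X N \<omega>)\<^sup>2)"
      using first(1) second(1) nonneg by (auto intro!: integrableI_nn_integral_finite)
    have "integral\<^sup>L M (X N) = a N" "integral\<^sup>L M (\<lambda>\<omega>. (X N \<omega>)\<^sup>2) = c N"
      using first second nonneg by (simp_all add: integral_eq_nn_integral)
    then have "integral\<^sup>L M (\<lambda>\<omega>. (X N \<omega>)\<^sup>2 - 2 * b * X N \<omega> + b\<^sup>2) = c N - 2 * b * a N + b\<^sup>2"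
      using int by (simp add: prob_space)
    moreover have square: "(X N \<omega> - b)\<^sup>2 = (X N \<omega>)\<^sup>2 - 2 * b * X N \<omega> + b\<^sup>2" for \<omega>
      by (simp add: power2_diff)
    ultimately have "integral\<^sup>L M (\<lambda>\<omega>. (X N \<omega> - b)\<^sup>2) = c N - 2 * b * a N + b\<^sup>2"
      by (simp only: square)
    moreover have "integrable M (\<lambda>\<omega>. (X N \<omega> - b)\<^sup>2)"
      unfolding square using int by simp
    then have "(\<integral>\<^sup>+\<omega>. ennreal ((X N \<omega> - b)\<^sup>2) \<partial>M) = ennreal (integral\<^sup>L M (\<lambda>\<omega>. (X N \<omega> - b)\<^sup>2))"
      by (rule nn_integral_eq_integral) simp
    ultimately show ?thesis by simp
  qed
  have "(\<lambda>N. ennreal (c N - 2 * b * a N + b\<^sup>2)) \<longlonglongrightarrow> ennreal (b\<^sup>2 - 2 * b * b + b\<^sup>2)"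
    by (intro tendsto_intros first second)
  then have lim0: "(\<lambda>N. \<integral>\<^sup>+\<omega>. ennreal ((X N \<omega> - b)\<^sup>2) \<partial>M) \<longlonglongrightarrow> 0"
    by (simp only: var) (simp add: power2_eq_square)
  have "ennreal ((L - b)\<^sup>2) = (\<integral>\<^sup>+\<omega>. ennreal ((L - b)\<^sup>2) \<partial>M)"
    by (simp add: emeasure_space_1)
  also have "\<dots> = (\<integral>\<^sup>+\<omega>. liminf (\<lambda>N. ennreal ((X N \<omega> - b)\<^sup>2)) \<partial>M)"
  proof (rule nn_integral_cong_AE)
    show "AE \<omega> in M. ennreal ((L - b)\<^sup>2) = liminf (\<lambda>N. ennreal ((X N \<omega> - b)\<^sup>2))"
      using lim
    proof eventually_elim
      case (elim \<omega>)
      have "(\<lambda>N. ennreal ((X N \<omega> - b)\<^sup>2)) \<longlonglongrightarrow> ennreal ((L - b)\<^sup>2)"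
        by (intro tendsto_intros elim)
      from lim_imp_Liminf[OF _ this] show ?case by simp
    qed
  qed
  also have "\<dots> \<le> liminf (\<lambda>N. \<integral>\<^sup>+\<omega>. ennreal ((X N \<omega> - b)\<^sup>2) \<partial>M)"
    by (rule nn_integral_liminf) measurable
  also have "\<dots> = 0"
    by (rule lim_imp_Liminf[OF _ lim0]) simp
  finally have "(L - b)\<^sup>2 \<le> 0" by simp
  then show ?thesis by simp
qed

text \<open>The logarithm of the left-hand side is \<open>t\<close> times a difference quotient of \<open>ln_Gamma\<close> at \<open>x\<close>, and
  \<open>Digamma\<close> is the derivative of \<open>ln_Gamma\<close>.\<close>

lemma Gamma_ratio_power_tendsto:
  fixes x t :: real
  assumes "x > 0" "t > 0"
  shows "(\<lambda>N. (Gamma (x + t / Suc N) / Gamma x) ^ Suc N) \<longlonglongrightarrow> exp (t * Digamma x)"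
proof -
  have "((\<lambda>h. (ln_Gamma (x + h) - ln_Gamma x) / h) \<longlongrightarrow> Digamma x) (at 0)"
    using has_field_derivative_ln_Gamma_real[OF assms(1)] by (simp add: DERIV_def)
  moreover have "filterlim (\<lambda>N. t / Suc N) (at 0) sequentially"
    unfolding filterlim_at using assms LIMSEQ_Suc[OF lim_const_over_n[of t]] by auto
  ultimately have "(\<lambda>N. (ln_Gamma (x + t / Suc N) - ln_Gamma x) / (t / Suc N)) \<longlonglongrightarrow> Digamma x"
    by (rule filterlim_compose)
  then have "(\<lambda>N. exp (t * ((ln_Gamma (x + t / Suc N) - ln_Gamma x) / (t / Suc N)))) \<longlonglongrightarrow> exp (t * Digamma x)"
    by (intro tendsto_intros)
  moreover have "exp (t * ((ln_Gamma (x + t / Suc N) - ln_Gamma x) / (t / Suc N))) =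
      (Gamma (x + t / Suc N) / Gamma x) ^ Suc N" for N
  proof -
    have pos: "x + t / Suc N > 0" using assms by (intro add_pos_pos) auto
    have "t * ((ln_Gamma (x + t / Suc N) - ln_Gamma x) / (t / Suc N)) =
          Suc N * (ln_Gamma (x + t / Suc N) - ln_Gamma x)"
      using assms by simp
    then have "exp (t * ((ln_Gamma (x + t / Suc N) - ln_Gamma x) / (t / Suc N))) =
          exp (ln_Gamma (x + t / Suc N) - ln_Gamma x) ^ Suc N"
      by (simp only: exp_of_nat_mult)
    then show ?thesis
      using assms(1) pos by (simp only: exp_diff Gamma_real_pos_exp)
  qed
  ultimately show ?thesis by simp
qed

text \<open>The exponent \<open>2 / Suc N\<close> puts the first and second moments of the geometric mean at the arguments
  \<open>1 / Suc N\<close> and \<open>2 / Suc N\<close> of the Mellin transform.\<close>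

lemma (in prob_space) gaussian_det_geometric_mean_limit:
  fixes G :: "nat \<Rightarrow> 'a \<Rightarrow> complex^'n^'n" and L :: real
  assumes normal: "\<And>i j k. i \<ge> 1 \<Longrightarrow> standard_complex_normal M (\<lambda>\<omega>. G i \<omega> $ j $ k)"
    and indep: "indep_vars (\<lambda>_. borel) (\<lambda>(i, j, k) \<omega>. G i \<omega> $ j $ k) ({1..} \<times> UNIV \<times> UNIV)"
    and lim: "AE \<omega> in M. (\<lambda>N. \<Prod>i=1..Suc N. cmod (det (G i \<omega>)) powr (2 / Suc N)) \<longlonglongrightarrow> L"
  shows "L = exp (\<Sum>m=1..CARD('n). Digamma (real m))"
proof -
  let ?X = "\<lambda>N \<omega>. \<Prod>i=1..Suc N. cmod (det (G i \<omega>)) powr (2 / Suc N)"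
  have det_meas: "(\<lambda>\<omega>. cmod (det (G i \<omega>))) \<in> borel_measurable M" if "i \<ge> 1" for i
    using measurable_det[of "G i", OF standard_complex_normal_distr(2)[OF normal[OF that]]]
    by measurable
  have det_indep: "indep_vars (\<lambda>_. borel) (\<lambda>i \<omega>. cmod (det (G i \<omega>))) {1..}"
  proof -
    have Y: "(\<lambda>g. cmod (det (\<chi> j k. g (i, j, k))))
        \<in> borel_measurable (Pi\<^sub>M ({i} \<times> UNIV \<times> UNIV) (\<lambda>_. borel))" for i :: nat
    proof -
      have "(\<lambda>g. det (\<chi> j k. g (i, j, k))) \<in>
          borel_measurable (Pi\<^sub>M ({i} \<times> UNIV \<times> UNIV) (\<lambda>_. borel :: complex measure))"
        by (rule measurable_det) (simp add: measurable_component_singleton)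
      then show ?thesis by measurable
    qed
    have "indep_vars (\<lambda>i. Pi\<^sub>M ({i} \<times> UNIV \<times> UNIV) (\<lambda>_. borel))
        (\<lambda>i \<omega>. restrict (\<lambda>x. (\<lambda>(i, j, k) \<omega>. G i \<omega> $ j $ k) x \<omega>) ({i} \<times> UNIV \<times> UNIV)) {1..}"
      by (rule indep_vars_restrict[OF indep]) (auto simp: disjoint_family_on_def)
    then have "indep_vars (\<lambda>_. borel)
        (\<lambda>i \<omega>. cmod (det (\<chi> j k. restrict (\<lambda>x. (\<lambda>(i, j, k) \<omega>. G i \<omega> $ j $ k) x \<omega>) ({i} \<times> UNIV \<times> UNIV) (i, j, k)))) {1..}"
      by (rule indep_vars_compose2[where Y = "\<lambda>i g. cmod (det (\<chi> j k. g (i, j, k)))"]) (rule Y)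
    then show ?thesis by simp
  qed
  have moment: "(\<integral>\<^sup>+\<omega>. ennreal (cmod (det (G i \<omega>)) powr (2 * s)) \<partial>M) =
      ennreal (\<Prod>m=1..CARD('n). Gamma (m + s) / Gamma m)" if "i \<ge> 1" "s \<ge> 0" for i and s :: real
  proof -
    have "indep_vars (\<lambda>_. borel) (\<lambda>(j, k) \<omega>. G i \<omega> $ j $ k) UNIV"
      using indep_vars_reindex[OF indep, of "\<lambda>(j, k). (i, j, k)" UNIV] that
      by (auto simp: inj_on_def case_prod_unfold)
    from complex_gaussian_det_moment[OF normal[OF that(1)] this that(2)] that(2)
    show ?thesis
      by (subst (asm) prod_ennreal) (auto intro!: divide_nonneg_nonneg less_imp_le Gamma_real_pos)
  qed
  have prod_moment: "(\<integral>\<^sup>+\<omega>. ennreal (\<Prod>i=1..Suc N. cmod (det (G i \<omega>)) powr (2 * (t / Suc N))) \<partial>M) =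
      ennreal (\<Prod>m=1..CARD('n). (Gamma (m + t / Suc N) / Gamma m) ^ Suc N)" if "t \<ge> 0" for t :: real and N
  proof -
    have "indep_vars (\<lambda>_. borel) (\<lambda>i \<omega>. ennreal (cmod (det (G i \<omega>)) powr (2 * (t / Suc N)))) {1..Suc N}"
      by (rule indep_vars_compose2[OF indep_vars_subset[OF det_indep]]) auto
    then have "(\<integral>\<^sup>+\<omega>. (\<Prod>i=1..Suc N. ennreal (cmod (det (G i \<omega>)) powr (2 * (t / Suc N)))) \<partial>M) =
      (\<Prod>i=1..Suc N. \<integral>\<^sup>+\<omega>. ennreal (cmod (det (G i \<omega>)) powr (2 * (t / Suc N))) \<partial>M)"
      by (intro indep_vars_nn_integral) auto
    also have "\<dots> = (\<Prod>i=1..Suc N. ennreal (\<Prod>m=1..CARD('n). Gamma (m + t / Suc N) / Gamma m))"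
      using that by (intro prod.cong refl moment) auto
    also have "\<dots> = ennreal (\<Prod>m=1..CARD('n). (Gamma (m + t / Suc N) / Gamma m) ^ Suc N)"
    proof -
      have "0 \<le> (\<Prod>m=1..CARD('n). Gamma (m + t / Suc N) / Gamma m)"
        using that by (intro prod_nonneg ballI divide_nonneg_nonneg less_imp_le[OF Gamma_real_pos] add_pos_nonneg) auto
      then show ?thesis
        by (simp add: ennreal_power prod_power_distrib[symmetric] del: power_Suc of_nat_Suc)
    qed
    finally show ?thesis by (simp only: prod_ennreal powr_ge_zero simp_thms)
  qed
  have moment_lim: "(\<lambda>N. \<Prod>m=1..CARD('n). (Gamma (real m + t / Suc N) / Gamma (real m)) ^ Suc N)
      \<longlonglongrightarrow> exp (t * (\<Sum>m=1..CARD('n). Digamma (real m)))" if "t > 0" for t :: real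
  proof -
    have "(\<lambda>N. \<Prod>m=1..CARD('n). (Gamma (real m + t / Suc N) / Gamma (real m)) ^ Suc N)
      \<longlonglongrightarrow> (\<Prod>m=1..CARD('n). exp (t * Digamma (real m)))"
      by (intro tendsto_prod Gamma_ratio_power_tendsto that) auto
    then show ?thesis by (simp add: exp_sum sum_distrib_left)
  qed
  show ?thesis
  proof (rule AE_limit_eq_of_moments[OF _ _ _ _ _ _ _ _ lim])
    show "?X N \<in> borel_measurable M" for N
      by (intro borel_measurable_prod measurable_compose[OF det_meas, where g = "\<lambda>x. x powr _"]) auto
    show "0 \<le> ?X N \<omega>" for N \<omega> by (simp add: prod_nonneg)
    show "(\<integral>\<^sup>+\<omega>. ennreal (?X N \<omega>) \<partial>M) =
        ennreal (\<Prod>m=1..CARD('n). (Gamma (m + 1 / Suc N) / Gamma m) ^ Suc N)" for N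
      using prod_moment[of 1 N] by simp
    show "(\<lambda>N. \<Prod>m=1..CARD('n). (Gamma (real m + 1 / Suc N) / Gamma (real m)) ^ Suc N)
        \<longlonglongrightarrow> exp (\<Sum>m=1..CARD('n). Digamma (real m))"
      using moment_lim[of 1] by simp
    show "(\<integral>\<^sup>+\<omega>. ennreal ((?X N \<omega>)\<^sup>2) \<partial>M) =
        ennreal (\<Prod>m=1..CARD('n). (Gamma (m + 2 / Suc N) / Gamma m) ^ Suc N)" for N
    proof -
      have "(?X N \<omega>)\<^sup>2 = (\<Prod>i=1..Suc N. cmod (det (G i \<omega>)) powr (2 * (2 / Suc N)))" for \<omega>
      proof -
        have "(x powr (2 / Suc N))\<^sup>2 = x powr (2 * (2 / Suc N))" for x :: real
          by (simp add: power2_eq_square powr_add[symmetric] del: of_nat_Suc)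
        then show ?thesis by (simp only: prod_power_distrib)
      qed
      then show ?thesis using prod_moment[of 2 N] by simp
    qed
    show "(\<lambda>N. \<Prod>m=1..CARD('n). (Gamma (real m + 2 / Suc N) / Gamma (real m)) ^ Suc N)
        \<longlonglongrightarrow> (exp (\<Sum>m=1..CARD('n). Digamma (real m)))\<^sup>2"
      using moment_lim[of 2] by (simp add: exp_double)
    show "0 \<le> (\<Prod>m=1..CARD('n). (Gamma (real m + 1 / Suc N) / Gamma (real m)) ^ Suc N)"
      "0 \<le> (\<Prod>m=1..CARD('n). (Gamma (real m + 2 / Suc N) / Gamma (real m)) ^ Suc N)" for N
      by (intro prod_nonneg ballI zero_le_power divide_nonneg_nonneg less_imp_le[OF Gamma_real_pos]
          add_pos_nonneg; simp)+
  qed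
qed

section \<open>The sum of the Lyapunov exponents\<close>

lemma det_matprod: "det (matprod A N) = (\<Prod>i=1..N. det (A i))"
  by (induction N) (simp_all add: det_mul mult.commute)

lemma tendsto_det:
  fixes V :: "complex^'n^'n"
  assumes "(A \<longlongrightarrow> V) F"
  shows "((\<lambda>x. det (A x)) \<longlongrightarrow> det V) F"
  unfolding det_def by (intro tendsto_intros tendsto_vec_nth assms)

theorem corollary1:
  fixes M :: "'w measure"
    and \<Sigma> :: "complex^'n^'n"
    and G :: "nat \<Rightarrow> 'w \<Rightarrow> complex^'n^'n"
    and y \<mu> :: "nat \<Rightarrow> real"
  assumes "prob_space M"
    and "pos_def \<Sigma>"
    and "\<And>i j k. i \<ge> 1 \<Longrightarrow> standard_complex_normal M (\<lambda>\<omega>. G i \<omega> $ j $ k)"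
    and "prob_space.indep_vars M (\<lambda>_. borel) (\<lambda>(i, j, k) \<omega>. G i \<omega> $ j $ k) ({1..} \<times> UNIV \<times> UNIV)"
    and "eigenvalues (matrix_inv \<Sigma>) =
           image_mset (\<lambda>m. complex_of_real (y m)) (mset_set {1..CARD('n)})"
    and "lyapunov_exponents M (\<lambda>i \<omega>. pos_def_sqrt \<Sigma> ** G i \<omega>) \<mu>"
  shows "(\<Sum>m=1..CARD('n). \<mu> m) = 1/2 * (\<Sum>m=1..CARD('n). - ln (y m) + Digamma (real m))"
proof -
  interpret prob_space M by fact
  define q where "q = cmod (det (pos_def_sqrt \<Sigma>))"
  have q2: "q\<^sup>2 = cmod (det \<Sigma>)"
    using pos_def_sqrt_square[OF assms(2)]
    by (metis det_mul norm_mult power2_eq_square q_def)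
  have det\<Sigma>: "det \<Sigma> \<noteq> 0" by (rule pos_def_imp_det_nonzero) fact
  then have q: "q > 0" using q2 by (simp add: q_def) force
  have eigen_prod: "det B = of_real (\<Prod>m=1..CARD('n). f m)"
    if "eigenvalues B = image_mset (\<lambda>m. complex_of_real (f m)) (mset_set {1..CARD('n)})"
    for B :: "complex^'n^'n" and f :: "nat \<Rightarrow> real"
    unfolding det_eq_prod_eigenvalues that by (simp add: prod_unfold_prod_mset[symmetric])
  have ln_q: "ln (q\<^sup>2) = (\<Sum>m=1..CARD('n). - ln (y m))"
  proof -
    have "\<Sigma> ** matrix_inv \<Sigma> = mat 1"
      using det\<Sigma> invertible_det_nz[of \<Sigma>] someI_ex unfolding invertible_def matrix_inv_def
      by (metis (mono_tags, lifting))
    then have "det \<Sigma> * of_real (\<Prod>m=1..CARD('n). y m) = 1"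
      by (metis det_I det_mul eigen_prod[OF assms(5)])
    then have "cmod (det \<Sigma>) * \<bar>\<Prod>m=1..CARD('n). y m\<bar> = 1"
      by (metis norm_mult norm_of_real norm_one)
    moreover from this have "(\<Prod>m=1..CARD('n). y m) \<noteq> 0"
      by (metis abs_zero mult_zero_right zero_neq_one)
    ultimately have "ln (q\<^sup>2) + ln \<bar>\<Prod>m=1..CARD('n). y m\<bar> = 0"
      using ln_mult[of "cmod (det \<Sigma>)" "\<bar>\<Prod>m=1..CARD('n). y m\<bar>"] det\<Sigma> by (simp add: q2)
    moreover have "ln \<bar>\<Prod>m=1..CARD('n). y m\<bar> = (\<Sum>m=1..CARD('n). ln (y m))"
      using \<open>(\<Prod>m=1..CARD('n). y m) \<noteq> 0\<close>
      by (subst ln_prod[symmetric]) (auto simp: ln_real_def prod_zero_iff)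
    ultimately show ?thesis by (simp add: sum_negf)
  qed
  \<comment> \<open>the limit of the geometric means of the \<open>\<bar>det (G i)\<bar>\<^sup>2\<close>, once the factor of \<open>\<Sigma>\<close> is divided out\<close>
  define L where "L = exp (2 * (\<Sum>m=1..CARD('n). \<mu> m)) / q\<^sup>2"
  have "L = exp (\<Sum>m=1..CARD('n). Digamma (real m))"
  proof (rule gaussian_det_geometric_mean_limit[OF assms(3,4)])
    have "AE \<omega> in M. \<exists>V.
        (\<lambda>N. pos_semidef_root (2 * N)
               (conj_transpose (matprod (\<lambda>i. pos_def_sqrt \<Sigma> ** G i \<omega>) N) **
                matprod (\<lambda>i. pos_def_sqrt \<Sigma> ** G i \<omega>) N)) \<longlonglongrightarrow> V \<and>
        eigenvalues V = image_mset (\<lambda>m. complex_of_real (exp (\<mu> m))) (mset_set {1..CARD('n)})"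
      using assms(6) by (simp add: lyapunov_exponents_def)
    then show "AE \<omega> in M. (\<lambda>N. \<Prod>i=1..Suc N. cmod (det (G i \<omega>)) powr (2 / Suc N)) \<longlonglongrightarrow> L"
    proof eventually_elim
      case (elim \<omega>)
      let ?P = "matprod (\<lambda>i. pos_def_sqrt \<Sigma> ** G i \<omega>)"
      obtain V where V: "(\<lambda>N. pos_semidef_root (2 * N) (conj_transpose (?P N) ** ?P N)) \<longlonglongrightarrow> V"
        "eigenvalues V = image_mset (\<lambda>m. complex_of_real (exp (\<mu> m))) (mset_set {1..CARD('n)})"
        using elim by blast
      have "(\<lambda>N. cmod (det (pos_semidef_root (2 * Suc N) (conj_transpose (?P (Suc N)) ** ?P (Suc N)))))
          \<longlonglongrightarrow> cmod (det V)"
        by (intro tendsto_norm tendsto_det LIMSEQ_Suc[OF V(1)])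
      moreover have "cmod (det V) = exp (\<Sum>m=1..CARD('n). \<mu> m)"
        unfolding eigen_prod[OF V(2)] norm_of_real by (simp add: exp_sum abs_of_nonneg prod_nonneg)
      moreover have root: "cmod (det (pos_semidef_root (2 * Suc N)
          (conj_transpose (?P (Suc N)) ** ?P (Suc N)))) = cmod (det (?P (Suc N))) powr (1 / Suc N)" for N
        by (subst det_root_gram) auto
      ultimately have "(\<lambda>N. cmod (det (?P (Suc N))) powr (1 / Suc N)) \<longlonglongrightarrow> exp (\<Sum>m=1..CARD('n). \<mu> m)"
        by (simp only: root)
      then have "(\<lambda>N. (cmod (det (?P (Suc N))) powr (1 / Suc N))\<^sup>2 / q\<^sup>2) \<longlonglongrightarrow> (exp (\<Sum>m=1..CARD('n). \<mu> m))\<^sup>2 / q\<^sup>2"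
        using q by (intro tendsto_intros) auto
      moreover have "(cmod (det (?P (Suc N))) powr (1 / Suc N))\<^sup>2 / q\<^sup>2 =
          (\<Prod>i=1..Suc N. cmod (det (G i \<omega>)) powr (2 / Suc N))" for N
      proof -
        have "cmod (det (?P (Suc N))) = q ^ Suc N * (\<Prod>i=1..Suc N. cmod (det (G i \<omega>)))"
          unfolding det_matprod det_mul prod_norm[symmetric]
          by (simp add: norm_mult prod.distrib q_def del: prod.cl_ivl_Suc power_Suc)
        then have "cmod (det (?P (Suc N))) powr (1 / Suc N) =
            (q powr Suc N) powr (1 / Suc N) * (\<Prod>i=1..Suc N. cmod (det (G i \<omega>))) powr (1 / Suc N)"
          using q by (simp only: powr_mult powr_realpow)
        also have "(q powr Suc N) powr (1 / Suc N) = q"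
          using q by (simp add: powr_powr del: of_nat_Suc)
        also have "(\<Prod>i=1..Suc N. cmod (det (G i \<omega>))) powr (1 / Suc N) =
            (\<Prod>i=1..Suc N. cmod (det (G i \<omega>)) powr (1 / Suc N))"
          by (rule prod_powr_distrib)
        finally have "cmod (det (?P (Suc N))) powr (1 / Suc N) =
            q * (\<Prod>i=1..Suc N. cmod (det (G i \<omega>)) powr (1 / Suc N))" .
        moreover have "(x powr (1 / Suc N))\<^sup>2 = x powr (2 / Suc N)" for x :: real
          by (simp add: power2_eq_square powr_add[symmetric] del: of_nat_Suc)
        ultimately show ?thesis
          using q by (simp only: power_mult_distrib prod_power_distrib) simp
      qed
      ultimately show ?case by (simp add: L_def exp_double)
    qed
  qed
  then have "exp (2 * (\<Sum>m=1..CARD('n). \<mu> m)) = exp (ln (q\<^sup>2) + (\<Sum>m=1..CARD('n). Digamma (real m)))"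
    using q by (simp add: L_def exp_add field_simps)
  then have "2 * (\<Sum>m=1..CARD('n). \<mu> m) = ln (q\<^sup>2) + (\<Sum>m=1..CARD('n). Digamma (real m))"
    by simp
  then show ?thesis
    unfolding ln_q by (simp add: sum.distrib sum_subtractf sum_negf)
qed

end
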